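(* Let $G$ be a unicyclic graph with a unique cycle $C_{2n+1}=(x_1,\ldots,x_{2n+1})$, and let $I=I(G)\subset R$ be its edge ideal. Let $s\in\mathbb{N}$ and write $s=k(n+1)+r$ for some $k\in\mathbb{Z}$ and $0\le r\le n$. Assume that $s\ge n+1$. Let $\mathfrak{m}$ be the maximal homogeneous ideal of $R$ generated by the elements of $V(G)$. (i) If there exists some vertex of $G$ which does not lie in the set $N_G[V(C_{2n+1})]$, then $\mathfrak{m}^{\gamma(s)}I^{(s)}\nsubseteq I^s$ for any $\gamma(s)$; hence no power of the maximal ideal $\mathfrak{m}$ annihilates $I^{(s)}/I^s$. (ii) If each vertex of $G$ lies in the set $N_G[V(C_{2n+1})]$, then $\mathfrak{m}^{k}I^{(s)}\subseteq I^s$ and $\mathfrak{m}^{k-1}I^{(s)}\nsubseteq I^s$, so that $k$ is the least integer such that $\mathfrak{m}^{k}I^{(s)}\subseteq I^s$. Hence $\mathfrak{m}^{\gamma(s)}\cdot(I^{(s)}/I^s)=0$ where $\gamma(s)\ge k$, and $\gamma(s)$ increases as $s$ increases.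
   Context: Graphs are finite and simple; $G$ is unicyclic with unique cycle $C_{2n+1}$ if the odd cycle $C_{2n+1}$ on the vertices $x_1,\ldots,x_{2n+1}$ is the only cycle of $G$. $R$ is the polynomial ring over a field whose variables are the vertices of $G$, and the edge ideal is $I(G)=\langle uv : \{u,v\}\in E(G)\rangle\subset R$. The $s$-th symbolic power of $I$ is $I^{(s)}=\bigcap_{p\in\operatorname{Ass} I}(I^sR_p\cap R)$. For $W\subseteq V(G)$, $N_G[W]$ is the union of $W$ with the set of all vertices adjacent to some vertex of $W$. Here $\gamma(s)$ denotes an exponent, depending on $s$, of the maximal ideal $\mathfrak{m}$; the question being answered is what the annihilator of $I^{(s)}/I^s$ is and how an exponent $\gamma(s)$ with $\mathfrak{m}^{\gamma(s)}\cdot(I^{(s)}/I^s)=0$ depends on $s$. *)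

theory Defs
  imports
    "HOL-Algebra.Ideal_Product"
    "HOL-Algebra.QuotRing"
    "HOL-Algebra.Module"
    "HOL-Algebra.Algebraic_Closure_Type"
    "HOL-Library.Poly_Mapping"
begin

section \<open>Simple graphs on a finite vertex type\<close>

text \<open>The vertex set is the whole (finite) type \<open>'v\<close>; a graph is given by its set of edges.\<close>

definition simple_graph :: "'v::finite set set \<Rightarrow> bool" where
  "simple_graph E \<longleftrightarrow> (\<forall>e\<in>E. card e = 2)"

definition cycle_edges :: "'v list \<Rightarrow> 'v set set" where
  "cycle_edges xs = {{xs ! i, xs ! (Suc i mod length xs)} | i. i < length xs}"

definition is_cycle :: "'v set set \<Rightarrow> 'v list \<Rightarrow> bool" where
  "is_cycle E xs \<longleftrightarrow> 3 \<le> length xs \<and> distinct xs \<and> cycle_edges xs \<subseteq> E"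

text \<open>A cycle is a subgraph: vertex lists differing by rotation or reflection are the same cycle,
  which is why uniqueness is expressed through the edge sets.\<close>

definition unicyclic :: "'v::finite set set \<Rightarrow> 'v list \<Rightarrow> bool" where
  "unicyclic E xs \<longleftrightarrow> simple_graph E \<and> is_cycle E xs \<and>
     (\<forall>ys. is_cycle E ys \<longrightarrow> cycle_edges ys = cycle_edges xs)"

definition closed_nbhd :: "'v set set \<Rightarrow> 'v set \<Rightarrow> 'v set" where
  "closed_nbhd E W = W \<union> {v. \<exists>w\<in>W. {v, w} \<in> E}"


section \<open>Quotient modules, annihilators and associated primes\<close>

text \<open>The module \<open>M / N\<close> for ideals \<open>N \<subseteq> M\<close> of \<open>R\<close>. The fields \<open>mult\<close> and \<open>one\<close>, which a module
  record inherits from rings, play no role.\<close>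

definition quot_module :: "('a, 'b) ring_scheme \<Rightarrow> 'a set \<Rightarrow> 'a set \<Rightarrow> ('a, 'a set) module" where
  "quot_module R M N =
     \<lparr>carrier = {N +>\<^bsub>R\<^esub> f | f. f \<in> M}, monoid.mult = rcoset_mult R N, one = N +>\<^bsub>R\<^esub> \<one>\<^bsub>R\<^esub>,
      ring.zero = N, add = set_add R, module.smult = (\<lambda>a A. \<Union>x\<in>A. N +>\<^bsub>R\<^esub> (a \<otimes>\<^bsub>R\<^esub> x))\<rparr>"

definition annihilator :: "('a, 'c) ring_scheme \<Rightarrow> ('a, 'b, 'd) module_scheme \<Rightarrow> 'a set" where
  "annihilator R M = {a \<in> carrier R. \<forall>x\<in>carrier M. a \<odot>\<^bsub>M\<^esub> x = \<zero>\<^bsub>M\<^esub>}"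

definition associated_primes :: "('a, 'c) ring_scheme \<Rightarrow> ('a, 'b, 'd) module_scheme \<Rightarrow> 'a set set" where
  "associated_primes R M =
     {P. primeideal P R \<and> (\<exists>x\<in>carrier M. P = {a \<in> carrier R. a \<odot>\<^bsub>M\<^esub> x = \<zero>\<^bsub>M\<^esub>})}"

text \<open>\<open>Ass I\<close> is understood as the set of associated primes of the module \<open>R / I\<close>.\<close>

definition Ass :: "('a, 'b) ring_scheme \<Rightarrow> 'a set \<Rightarrow> 'a set set" where
  "Ass R I = associated_primes R (quot_module R (carrier R) I)"


section \<open>Localization\<close>

text \<open>The fraction \<open>a / u\<close>, as an equivalence class of pairs.\<close>

definition loc_frac :: "('a, 'b) ring_scheme \<Rightarrow> 'a set \<Rightarrow> 'a \<Rightarrow> 'a \<Rightarrow> ('a \<times> 'a) set" where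
  "loc_frac R S a u = {(b, v). b \<in> carrier R \<and> v \<in> S \<and>
     (\<exists>w\<in>S. w \<otimes>\<^bsub>R\<^esub> (v \<otimes>\<^bsub>R\<^esub> a \<ominus>\<^bsub>R\<^esub> u \<otimes>\<^bsub>R\<^esub> b) = \<zero>\<^bsub>R\<^esub>)}"

definition localization :: "('a, 'b) ring_scheme \<Rightarrow> 'a set \<Rightarrow> ('a \<times> 'a) set ring" where
  "localization R S =
     \<lparr>carrier = {loc_frac R S a u | a u. a \<in> carrier R \<and> u \<in> S},
      monoid.mult = (\<lambda>A B. \<Union>(a, u)\<in>A. \<Union>(b, v)\<in>B. loc_frac R S (a \<otimes>\<^bsub>R\<^esub> b) (u \<otimes>\<^bsub>R\<^esub> v)),
      one = loc_frac R S \<one>\<^bsub>R\<^esub> \<one>\<^bsub>R\<^esub>,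
      ring.zero = loc_frac R S \<zero>\<^bsub>R\<^esub> \<one>\<^bsub>R\<^esub>,
      add = (\<lambda>A B. \<Union>(a, u)\<in>A. \<Union>(b, v)\<in>B.
               loc_frac R S (v \<otimes>\<^bsub>R\<^esub> a \<oplus>\<^bsub>R\<^esub> u \<otimes>\<^bsub>R\<^esub> b) (u \<otimes>\<^bsub>R\<^esub> v))\<rparr>"

definition localization_map :: "('a, 'b) ring_scheme \<Rightarrow> 'a set \<Rightarrow> 'a \<Rightarrow> ('a \<times> 'a) set" where
  "localization_map R S a = loc_frac R S a \<one>\<^bsub>R\<^esub>"

abbreviation localization_at :: "('a, 'b) ring_scheme \<Rightarrow> 'a set \<Rightarrow> ('a \<times> 'a) set ring" where
  "localization_at R P \<equiv> localization R (carrier R - P)"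

text \<open>\<open>J R\<^sub>P \<inter> R\<close>: extend \<open>J\<close> to the local ring, then take the preimage in \<open>R\<close>.\<close>

definition local_contraction :: "('a, 'b) ring_scheme \<Rightarrow> 'a set \<Rightarrow> 'a set \<Rightarrow> 'a set" where
  "local_contraction R P J =
     {f \<in> carrier R. localization_map R (carrier R - P) f
        \<in> genideal (localization_at R P) (localization_map R (carrier R - P) ` J)}"


section \<open>Ordinary and symbolic powers of ideals\<close>

abbreviation ideal_pow :: "('a, 'b) ring_scheme \<Rightarrow> 'a set \<Rightarrow> nat \<Rightarrow> 'a set" where
  "ideal_pow R I s \<equiv> I [^]\<^bsub>ideals_set R\<^esub> s"

definition symbolic_power :: "('a, 'b) ring_scheme \<Rightarrow> 'a set \<Rightarrow> nat \<Rightarrow> 'a set" where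
  "symbolic_power R I s =
     carrier R \<inter> (\<Inter>P\<in>Ass R I. local_contraction R P (ideal_pow R I s))"


section \<open>The polynomial ring on the vertices and the edge ideal\<close>

type_synonym ('v, 'k) vpoly = "('v \<Rightarrow>\<^sub>0 nat) \<Rightarrow>\<^sub>0 'k"

abbreviation vpoly_ring :: "('v, 'k::field) vpoly ring" where
  "vpoly_ring \<equiv> ring_of_type_algebra"

definition Var :: "'v \<Rightarrow> ('v, 'k::field) vpoly" where
  "Var v = Poly_Mapping.single (Poly_Mapping.single v 1) 1"

definition edge_ideal :: "'v set set \<Rightarrow> ('v, 'k::field) vpoly set" where
  "edge_ideal E = genideal vpoly_ring {Var u * Var v | u v. {u, v} \<in> E}"

definition max_ideal :: "('v, 'k::field) vpoly set" where
  "max_ideal = genideal vpoly_ring (range Var)"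

definition least_exponent :: "('v, 'k::field) vpoly set \<Rightarrow> nat \<Rightarrow> nat" where
  "least_exponent I s =
     (LEAST j. ideal_prod vpoly_ring (ideal_pow vpoly_ring max_ideal j)
                 (symbolic_power vpoly_ring I s) \<subseteq> ideal_pow vpoly_ring I s)"


section \<open>The constructions above behave as they should\<close>

lemma UN_pairs_const:
  assumes "\<And>a u b v. \<lbrakk>(a, u) \<in> A; (b, v) \<in> B\<rbrakk> \<Longrightarrow> f a u b v = C" "p \<in> A" "q \<in> B"
  shows "(\<Union>(a, u)\<in>A. \<Union>(b, v)\<in>B. f a u b v) = C"
proof -
  have "(case x of (a, u) \<Rightarrow> \<Union>(b, v)\<in>B. f a u b v) = C" if "x \<in> A" for x
  proof -
    have "(case y of (b, v) \<Rightarrow> f (fst x) (snd x) b v) = C" if "y \<in> B" for y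
      using assms(1)[of "fst x" "snd x" "fst y" "snd y"] \<open>x \<in> A\<close> that by (simp add: case_prod_beta)
    then show ?thesis using assms(3) by (simp add: case_prod_beta) blast
  qed
  then show ?thesis using assms(2) by blast
qed

locale mult_subset = cring R for R (structure) +
  fixes S
  assumes S_sub: "S \<subseteq> carrier R" and S_one: "\<one> \<in> S"
    and S_mult: "\<lbrakk>u \<in> S; v \<in> S\<rbrakk> \<Longrightarrow> u \<otimes> v \<in> S"
begin

lemma S_carr: "u \<in> S \<Longrightarrow> u \<in> carrier R"
  using S_sub by blast

definition frac_rel where
  "frac_rel a u b v \<longleftrightarrow> (\<exists>w\<in>S. w \<otimes> (v \<otimes> a \<ominus> u \<otimes> b) = \<zero>)"

lemma frac_rel_sym:
  assumes "a \<in> carrier R" "b \<in> carrier R" "u \<in> S" "v \<in> S" "frac_rel a u b v"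
  shows "frac_rel b v a u"
proof -
  obtain w where w: "w \<in> S" "w \<otimes> (v \<otimes> a \<ominus> u \<otimes> b) = \<zero>" using assms unfolding frac_rel_def by blast
  note c = assms(1,2) S_carr[OF assms(3)] S_carr[OF assms(4)] S_carr[OF w(1)]
  have "w \<otimes> (u \<otimes> b \<ominus> v \<otimes> a) = \<ominus> (w \<otimes> (v \<otimes> a \<ominus> u \<otimes> b))" using c by (simp add: a_minus_def r_distr l_distr r_minus l_minus minus_add r_neg l_neg r_neg1 r_neg2 a_ac m_ac)
  with w show ?thesis unfolding frac_rel_def by auto
qed

lemma frac_rel_trans:
  assumes "a \<in> carrier R" "b \<in> carrier R" "c \<in> carrier R" "u \<in> S" "v \<in> S" "t \<in> S"
    "frac_rel a u b v" "frac_rel b v c t"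
  shows "frac_rel a u c t"
proof -
  obtain w where w: "w \<in> S" "w \<otimes> (v \<otimes> a \<ominus> u \<otimes> b) = \<zero>" using assms unfolding frac_rel_def by blast
  obtain x where x: "x \<in> S" "x \<otimes> (t \<otimes> b \<ominus> v \<otimes> c) = \<zero>" using assms unfolding frac_rel_def by blast
  note cc = assms(1-3) assms(4-6)[THEN S_carr] S_carr[OF w(1)] S_carr[OF x(1)]
  have "(w \<otimes> x \<otimes> v) \<otimes> (t \<otimes> a \<ominus> u \<otimes> c) =
     (x \<otimes> t) \<otimes> (w \<otimes> (v \<otimes> a \<ominus> u \<otimes> b)) \<oplus> (w \<otimes> u) \<otimes> (x \<otimes> (t \<otimes> b \<ominus> v \<otimes> c))"
    using cc by (simp add: a_minus_def r_distr l_distr r_minus l_minus minus_add r_neg l_neg r_neg1 r_neg2 a_ac m_ac)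
  also have "\<dots> = \<zero>" using w x cc by simp
  finally show ?thesis unfolding frac_rel_def using S_mult w x assms by blast
qed

lemma frac_rel_refl: "a \<in> carrier R \<Longrightarrow> u \<in> S \<Longrightarrow> frac_rel a u a u"
  unfolding frac_rel_def using S_one S_carr
  by (intro bexI[of _ \<one>]) (auto simp: r_right_minus_eq)

lemma mem_frac: "(b, v) \<in> loc_frac R S a u \<longleftrightarrow> b \<in> carrier R \<and> v \<in> S \<and> frac_rel a u b v"
  by (simp add: loc_frac_def frac_rel_def)

lemma frac_eq_iff:
  assumes "a \<in> carrier R" "b \<in> carrier R" "u \<in> S" "v \<in> S"
  shows "loc_frac R S a u = loc_frac R S b v \<longleftrightarrow> frac_rel a u b v"
proof
  assume "loc_frac R S a u = loc_frac R S b v"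
  then have "(b, v) \<in> loc_frac R S a u" using assms frac_rel_refl[of b v] by (simp add: mem_frac)
  then show "frac_rel a u b v" by (simp add: mem_frac)
next
  assume r: "frac_rel a u b v"
  have "x \<in> loc_frac R S a u \<longleftrightarrow> x \<in> loc_frac R S b v" for x
  proof (cases x)
    case (Pair c t)
    have "frac_rel a u c t \<longleftrightarrow> frac_rel b v c t" if "c \<in> carrier R" "t \<in> S"
      using frac_rel_trans[OF assms(2,1) that(1) assms(4,3) that(2) frac_rel_sym[OF assms r]]
        frac_rel_trans[OF assms(1,2) that(1) assms(3,4) that(2) r] by blast
    then show ?thesis using Pair by (auto simp: mem_frac)
  qed
  then show "loc_frac R S a u = loc_frac R S b v" by blast
qed

lemma mult_cong:
  assumes "a \<in> carrier R" "b \<in> carrier R" "u \<in> S" "v \<in> S"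
    "a' \<in> carrier R" "b' \<in> carrier R" "u' \<in> S" "v' \<in> S" "frac_rel a u a' u'" "frac_rel b v b' v'"
  shows "frac_rel (a \<otimes> b) (u \<otimes> v) (a' \<otimes> b') (u' \<otimes> v')"
proof -
  obtain w where w: "w \<in> S" "w \<otimes> (u' \<otimes> a \<ominus> u \<otimes> a') = \<zero>" using assms unfolding frac_rel_def by blast
  obtain x where x: "x \<in> S" "x \<otimes> (v' \<otimes> b \<ominus> v \<otimes> b') = \<zero>" using assms unfolding frac_rel_def by blast
  note cc = assms(1,2,5,6) assms(3,4,7,8)[THEN S_carr] S_carr[OF w(1)] S_carr[OF x(1)]
  have "(w \<otimes> x) \<otimes> ((u' \<otimes> v') \<otimes> (a \<otimes> b) \<ominus> (u \<otimes> v) \<otimes> (a' \<otimes> b')) =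
     (x \<otimes> v' \<otimes> b) \<otimes> (w \<otimes> (u' \<otimes> a \<ominus> u \<otimes> a')) \<oplus> (w \<otimes> u \<otimes> a') \<otimes> (x \<otimes> (v' \<otimes> b \<ominus> v \<otimes> b'))"
    using cc by (simp add: a_minus_def r_distr l_distr r_minus l_minus minus_add r_neg l_neg r_neg1 r_neg2 a_ac m_ac)
  also have "\<dots> = \<zero>" using w x cc by simp
  finally show ?thesis unfolding frac_rel_def using S_mult w x by blast
qed

lemma add_cong:
  assumes "a \<in> carrier R" "b \<in> carrier R" "u \<in> S" "v \<in> S"
    "a' \<in> carrier R" "b' \<in> carrier R" "u' \<in> S" "v' \<in> S" "frac_rel a u a' u'" "frac_rel b v b' v'"
  shows "frac_rel (v \<otimes> a \<oplus> u \<otimes> b) (u \<otimes> v) (v' \<otimes> a' \<oplus> u' \<otimes> b') (u' \<otimes> v')"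
proof -
  obtain w where w: "w \<in> S" "w \<otimes> (u' \<otimes> a \<ominus> u \<otimes> a') = \<zero>" using assms unfolding frac_rel_def by blast
  obtain x where x: "x \<in> S" "x \<otimes> (v' \<otimes> b \<ominus> v \<otimes> b') = \<zero>" using assms unfolding frac_rel_def by blast
  note cc = assms(1,2,5,6) assms(3,4,7,8)[THEN S_carr] S_carr[OF w(1)] S_carr[OF x(1)]
  have "(w \<otimes> x) \<otimes> ((u' \<otimes> v') \<otimes> (v \<otimes> a \<oplus> u \<otimes> b) \<ominus> (u \<otimes> v) \<otimes> (v' \<otimes> a' \<oplus> u' \<otimes> b')) =
     (x \<otimes> v \<otimes> v') \<otimes> (w \<otimes> (u' \<otimes> a \<ominus> u \<otimes> a')) \<oplus> (w \<otimes> u \<otimes> u') \<otimes> (x \<otimes> (v' \<otimes> b \<ominus> v \<otimes> b'))"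
    using cc by (simp add: a_minus_def r_distr l_distr r_minus l_minus minus_add r_neg l_neg r_neg1 r_neg2 a_ac m_ac)
  also have "\<dots> = \<zero>" using w x cc by simp
  finally show ?thesis unfolding frac_rel_def using S_mult w x by blast
qed

abbreviation "L \<equiv> localization R S"
abbreviation "fr \<equiv> loc_frac R S"

lemma mult_frac:
  assumes "a \<in> carrier R" "b \<in> carrier R" "u \<in> S" "v \<in> S"
  shows "fr a u \<otimes>\<^bsub>L\<^esub> fr b v = fr (a \<otimes> b) (u \<otimes> v)"
proof -
  have 1: "fr (a' \<otimes> b') (u' \<otimes> v') = fr (a \<otimes> b) (u \<otimes> v)"
    if "(a', u') \<in> fr a u" "(b', v') \<in> fr b v" for a' b' u' v'
  proof -
    have c: "a' \<in> carrier R" "u' \<in> S" "frac_rel a u a' u'" "b' \<in> carrier R" "v' \<in> S" "frac_rel b v b' v'"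
      using that by (auto simp: mem_frac)
    have r: "frac_rel a' u' a u" "frac_rel b' v' b v" using frac_rel_sym c assms by blast+
    show ?thesis
      by (subst frac_eq_iff) (use c assms r in \<open>simp_all add: S_mult S_carr mult_cong\<close>)
  qed
  have "(a, u) \<in> fr a u" "(b, v) \<in> fr b v" using assms frac_rel_refl by (simp_all add: mem_frac)
  from UN_pairs_const[OF 1 this] show ?thesis by (simp add: localization_def)
qed

lemma add_frac:
  assumes "a \<in> carrier R" "b \<in> carrier R" "u \<in> S" "v \<in> S"
  shows "fr a u \<oplus>\<^bsub>L\<^esub> fr b v = fr (v \<otimes> a \<oplus> u \<otimes> b) (u \<otimes> v)"
proof -
  have 1: "fr (v' \<otimes> a' \<oplus> u' \<otimes> b') (u' \<otimes> v') = fr (v \<otimes> a \<oplus> u \<otimes> b) (u \<otimes> v)"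
    if "(a', u') \<in> fr a u" "(b', v') \<in> fr b v" for a' b' u' v'
  proof -
    have c: "a' \<in> carrier R" "u' \<in> S" "frac_rel a u a' u'" "b' \<in> carrier R" "v' \<in> S" "frac_rel b v b' v'"
      using that by (auto simp: mem_frac)
    have r: "frac_rel a' u' a u" "frac_rel b' v' b v" using frac_rel_sym c assms by blast+
    show ?thesis
      by (subst frac_eq_iff) (use c assms r in \<open>simp_all add: S_mult S_carr add_cong\<close>)
  qed
  have "(a, u) \<in> fr a u" "(b, v) \<in> fr b v" using assms frac_rel_refl by (simp_all add: mem_frac)
  from UN_pairs_const[OF 1 this] show ?thesis by (simp add: localization_def)
qed

lemma frac_eqI:
  assumes "a \<in> carrier R" "b \<in> carrier R" "u \<in> S" "v \<in> S" "v \<otimes> a = u \<otimes> b"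
  shows "fr a u = fr b v"
  by (subst frac_eq_iff; (rule assms)?; unfold frac_rel_def)
    (rule bexI[of _ \<one>], use assms S_one S_carr in \<open>simp_all add: r_right_minus_eq\<close>)

lemma L_carrier: "carrier L = {fr a u | a u. a \<in> carrier R \<and> u \<in> S}"
  "\<one>\<^bsub>L\<^esub> = fr \<one> \<one>" "\<zero>\<^bsub>L\<^esub> = fr \<zero> \<one>"
  by (simp_all add: localization_def)

lemma frac_carr: "a \<in> carrier R \<Longrightarrow> u \<in> S \<Longrightarrow> fr a u \<in> carrier L"
  by (auto simp: L_carrier)

lemma L_cases:
  assumes "x \<in> carrier L"
  obtains a u where "x = fr a u" "a \<in> carrier R" "u \<in> S" "u \<in> carrier R"
  using assms S_carr by (auto simp: L_carrier(1))

lemma localization_cring: "cring L"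
proof -
  have cl: "\<And>x y. x \<in> carrier L \<Longrightarrow> y \<in> carrier L \<Longrightarrow> x \<oplus>\<^bsub>L\<^esub> y \<in> carrier L"
    by (elim L_cases) (simp add: add_frac frac_carr S_mult)
  have clm: "\<And>x y. x \<in> carrier L \<Longrightarrow> y \<in> carrier L \<Longrightarrow> x \<otimes>\<^bsub>L\<^esub> y \<in> carrier L"
    by (elim L_cases) (simp add: mult_frac frac_carr S_mult)
  have z: "\<zero>\<^bsub>L\<^esub> \<in> carrier L" "\<one>\<^bsub>L\<^esub> \<in> carrier L"
    by (simp_all add: L_carrier(2,3) frac_carr S_one)
  have com: "\<And>x y. x \<in> carrier L \<Longrightarrow> y \<in> carrier L \<Longrightarrow> x \<oplus>\<^bsub>L\<^esub> y = y \<oplus>\<^bsub>L\<^esub> x"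
    by (elim L_cases) (simp add: add_frac a_comm m_comm)
  have comm: "\<And>x y. x \<in> carrier L \<Longrightarrow> y \<in> carrier L \<Longrightarrow> x \<otimes>\<^bsub>L\<^esub> y = y \<otimes>\<^bsub>L\<^esub> x"
    by (elim L_cases) (simp add: mult_frac m_comm)
  have as: "x \<oplus>\<^bsub>L\<^esub> y \<oplus>\<^bsub>L\<^esub> z = x \<oplus>\<^bsub>L\<^esub> (y \<oplus>\<^bsub>L\<^esub> z)"
    and asm: "x \<otimes>\<^bsub>L\<^esub> y \<otimes>\<^bsub>L\<^esub> z = x \<otimes>\<^bsub>L\<^esub> (y \<otimes>\<^bsub>L\<^esub> z)"
    and dis: "(x \<oplus>\<^bsub>L\<^esub> y) \<otimes>\<^bsub>L\<^esub> z = x \<otimes>\<^bsub>L\<^esub> z \<oplus>\<^bsub>L\<^esub> y \<otimes>\<^bsub>L\<^esub> z"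
    if h: "x \<in> carrier L" "y \<in> carrier L" "z \<in> carrier L" for x y z
  proof -
    obtain a u where x: "x = fr a u" "a \<in> carrier R" "u \<in> S" "u \<in> carrier R"
      using L_cases[OF h(1)] by blast
    obtain b v where y: "y = fr b v" "b \<in> carrier R" "v \<in> S" "v \<in> carrier R"
      using L_cases[OF h(2)] by blast
    obtain d t where z: "z = fr d t" "d \<in> carrier R" "t \<in> S" "t \<in> carrier R"
      using L_cases[OF h(3)] by blast
    have e: "t \<otimes> (v \<otimes> a \<oplus> u \<otimes> b) \<oplus> u \<otimes> v \<otimes> d = v \<otimes> t \<otimes> a \<oplus> u \<otimes> (t \<otimes> b \<oplus> v \<otimes> d)"
      using x(2,4) y(2,4) z(2,4) by (simp add: a_minus_def r_distr l_distr r_minus l_minus minus_add r_neg l_neg r_neg1 r_neg2 a_ac m_ac)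
    show "x \<oplus>\<^bsub>L\<^esub> y \<oplus>\<^bsub>L\<^esub> z = x \<oplus>\<^bsub>L\<^esub> (y \<oplus>\<^bsub>L\<^esub> z)"
      using x y z by (simp add: add_frac S_mult e m_assoc[of u v t])
    show "x \<otimes>\<^bsub>L\<^esub> y \<otimes>\<^bsub>L\<^esub> z = x \<otimes>\<^bsub>L\<^esub> (y \<otimes>\<^bsub>L\<^esub> z)"
      using x y z by (simp add: mult_frac S_mult m_assoc)
    have e: "u \<otimes> t \<otimes> (v \<otimes> t) \<otimes> ((v \<otimes> a \<oplus> u \<otimes> b) \<otimes> d)
        = u \<otimes> v \<otimes> t \<otimes> (v \<otimes> t \<otimes> (a \<otimes> d) \<oplus> u \<otimes> t \<otimes> (b \<otimes> d))"
      using x(2,4) y(2,4) z(2,4) by (simp add: a_minus_def r_distr l_distr r_minus l_minus minus_add r_neg l_neg r_neg1 r_neg2 a_ac m_ac)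
    show "(x \<oplus>\<^bsub>L\<^esub> y) \<otimes>\<^bsub>L\<^esub> z = x \<otimes>\<^bsub>L\<^esub> z \<oplus>\<^bsub>L\<^esub> y \<otimes>\<^bsub>L\<^esub> z"
    proof -
      have "(x \<oplus>\<^bsub>L\<^esub> y) \<otimes>\<^bsub>L\<^esub> z = fr ((v \<otimes> a \<oplus> u \<otimes> b) \<otimes> d) (u \<otimes> v \<otimes> t)"
        using x y z by (simp add: add_frac mult_frac S_mult)
      also have "\<dots> = fr (v \<otimes> t \<otimes> (a \<otimes> d) \<oplus> u \<otimes> t \<otimes> (b \<otimes> d)) (u \<otimes> t \<otimes> (v \<otimes> t))"
        by (rule frac_eqI[OF _ _ _ _ e]) (use x(2-4) y(2-4) z(2-4) in \<open>simp_all add: S_mult\<close>)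
      also have "\<dots> = x \<otimes>\<^bsub>L\<^esub> z \<oplus>\<^bsub>L\<^esub> y \<otimes>\<^bsub>L\<^esub> z"
        using x y z by (simp add: add_frac mult_frac S_mult)
      finally show ?thesis .
    qed
  qed
  have one: "\<And>x. x \<in> carrier L \<Longrightarrow> \<one>\<^bsub>L\<^esub> \<otimes>\<^bsub>L\<^esub> x = x"
    by (elim L_cases) (simp add: mult_frac S_one L_carrier(2))
  have zero: "\<And>x. x \<in> carrier L \<Longrightarrow> \<zero>\<^bsub>L\<^esub> \<oplus>\<^bsub>L\<^esub> x = x"
    by (elim L_cases) (simp add: add_frac S_one L_carrier(3))
  have inv: "\<exists>y\<in>carrier L. y \<oplus>\<^bsub>L\<^esub> x = \<zero>\<^bsub>L\<^esub>" if h: "x \<in> carrier L" for x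
  proof -
    obtain a u where x: "x = fr a u" "a \<in> carrier R" "u \<in> S" "u \<in> carrier R"
      using L_cases[OF h] by blast
    have e: "u \<otimes> \<ominus> a \<oplus> u \<otimes> a = \<zero>" using x by (simp add: a_minus_def r_distr l_distr r_minus l_minus minus_add r_neg l_neg r_neg1 r_neg2 a_ac m_ac)
    have "fr (\<ominus> a) u \<oplus>\<^bsub>L\<^esub> x = fr \<zero> (u \<otimes> u)" using x e by (simp add: add_frac)
    also have "\<dots> = \<zero>\<^bsub>L\<^esub>" unfolding L_carrier(3)
      by (rule frac_eqI) (use x S_mult S_one in simp_all)
    finally show ?thesis by (rule bexI) (use x frac_carr in simp)
  qed
  show ?thesis
  proof (rule cringI)
    show "abelian_group L"
      by (rule abelian_groupI[OF cl z(1) as com zero inv])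
    show "Group.comm_monoid L"
      by (rule comm_monoidI[OF clm z(2) asm one comm])
  qed (rule dis)
qed

end

lemma (in cring) quot_module_is_module:
  assumes M: "ideal M R" and N: "ideal N R" and sub: "N \<subseteq> M"
  shows "module R (quot_module R M N)"
proof -
  interpret M: ideal M R by fact
  interpret N: ideal N R by fact
  let ?Q = "quot_module R M N"
  have Mc: "f \<in> carrier R" if "f \<in> M" for f using that by auto
  have add: "(N +> f) \<oplus>\<^bsub>?Q\<^esub> (N +> g) = N +> (f \<oplus> g)" if "f \<in> carrier R" "g \<in> carrier R" for f g
    using that by (simp add: quot_module_def N.a_rcos_sum)
  have sm: "a \<odot>\<^bsub>?Q\<^esub> (N +> f) = N +> (a \<otimes> f)" if "a \<in> carrier R" "f \<in> carrier R" for a f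
  proof -
    have "N +> (a \<otimes> x) = N +> (a \<otimes> f)" if x: "x \<in> N +> f" for x
    proof -
      obtain h where h: "h \<in> N" "x = h \<oplus> f" using x unfolding a_r_coset_def' by blast
      have "a \<otimes> x = (a \<otimes> h) \<oplus> (a \<otimes> f)" using h \<open>a \<in> _\<close> \<open>f \<in> _\<close> by (simp add: r_distr)
      moreover have "a \<otimes> h \<in> N" using h \<open>a \<in> _\<close> by (simp add: N.I_l_closed)
      ultimately have "a \<otimes> x \<in> N +> (a \<otimes> f)" by (auto simp: a_r_coset_def')
      then show ?thesis using N.a_repr_independence'[of "a \<otimes> x" "a \<otimes> f"] \<open>a \<in> _\<close> \<open>f \<in> _\<close> by simp
    qed
    moreover have "f \<in> N +> f" using that N.a_rcos_self by simp
    ultimately have "(\<Union>x\<in>N +> f. N +> (a \<otimes> x)) = N +> (a \<otimes> f)" by blast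
    then show ?thesis by (simp add: quot_module_def)
  qed
  have z: "\<zero>\<^bsub>?Q\<^esub> = N +> \<zero>"
    by (simp add: quot_module_def a_coset_join2 N.a_subgroup)
  have car: "carrier ?Q = {N +> f | f. f \<in> M}" by (simp add: quot_module_def)
  have cases: thesis if "x \<in> carrier ?Q" "\<And>f. \<lbrakk>x = N +> f; f \<in> M; f \<in> carrier R\<rbrakk> \<Longrightarrow> thesis" for x thesis
    using that Mc unfolding car by blast
  have mem: "N +> f \<in> carrier ?Q" if "f \<in> M" for f using that unfolding car by blast
  have ab: "abelian_group ?Q"
  proof (rule abelian_groupI)
    fix x y assume "x \<in> carrier ?Q" "y \<in> carrier ?Q"
    then show "x \<oplus>\<^bsub>?Q\<^esub> y \<in> carrier ?Q" by (elim cases) (simp add: add mem)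
    show "x \<oplus>\<^bsub>?Q\<^esub> y = y \<oplus>\<^bsub>?Q\<^esub> x" using \<open>x \<in> _\<close> \<open>y \<in> _\<close> by (elim cases) (simp add: add a_comm)
  next
    fix x y z assume "x \<in> carrier ?Q" "y \<in> carrier ?Q" "z \<in> carrier ?Q"
    then show "x \<oplus>\<^bsub>?Q\<^esub> y \<oplus>\<^bsub>?Q\<^esub> z = x \<oplus>\<^bsub>?Q\<^esub> (y \<oplus>\<^bsub>?Q\<^esub> z)"
      by (elim cases) (simp add: add a_assoc)
  next
    fix x assume "x \<in> carrier ?Q"
    then show "\<zero>\<^bsub>?Q\<^esub> \<oplus>\<^bsub>?Q\<^esub> x = x" by (elim cases) (simp add: add z)
    show "\<exists>y\<in>carrier ?Q. y \<oplus>\<^bsub>?Q\<^esub> x = \<zero>\<^bsub>?Q\<^esub>" using \<open>x \<in> carrier ?Q\<close>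
    proof (elim cases)
      fix f assume f: "x = N +> f" "f \<in> M" "f \<in> carrier R"
      show ?thesis
        by (rule bexI[of _ "N +> (\<ominus> f)"]) (use f in \<open>simp_all add: add z l_neg mem\<close>)
    qed
  qed (simp add: z mem)
  show ?thesis
  proof (rule moduleI[OF is_cring ab])
    fix a x assume "a \<in> carrier R" "x \<in> carrier ?Q"
    then show "a \<odot>\<^bsub>?Q\<^esub> x \<in> carrier ?Q" by (elim cases) (simp add: sm mem M.I_l_closed)
  next
    fix a b x assume "a \<in> carrier R" "b \<in> carrier R" "x \<in> carrier ?Q"
    then show "(a \<oplus> b) \<odot>\<^bsub>?Q\<^esub> x = a \<odot>\<^bsub>?Q\<^esub> x \<oplus>\<^bsub>?Q\<^esub> b \<odot>\<^bsub>?Q\<^esub> x"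
      and "(a \<otimes> b) \<odot>\<^bsub>?Q\<^esub> x = a \<odot>\<^bsub>?Q\<^esub> (b \<odot>\<^bsub>?Q\<^esub> x)"
      by (elim cases, simp add: sm add l_distr m_assoc)+
  next
    fix a x y assume "a \<in> carrier R" "x \<in> carrier ?Q" "y \<in> carrier ?Q"
    then show "a \<odot>\<^bsub>?Q\<^esub> (x \<oplus>\<^bsub>?Q\<^esub> y) = a \<odot>\<^bsub>?Q\<^esub> x \<oplus>\<^bsub>?Q\<^esub> a \<odot>\<^bsub>?Q\<^esub> y"
      by (elim cases) (simp add: sm add r_distr)
  next
    fix x assume "x \<in> carrier ?Q"
    then show "\<one> \<odot>\<^bsub>?Q\<^esub> x = x" by (elim cases) (simp add: sm)
  qed
qed

lemma mult_subset_prime: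
  assumes "primeideal P R"
  shows "mult_subset R (carrier R - P)"
proof -
  interpret primeideal P R by fact
  show ?thesis
    apply unfold_locales
    using I_notcarr I_prime one_imp_carrier by auto
qed

lemma (in mult_subset) ideal_extension:
  assumes J: "ideal J R"
  shows "genideal L (localization_map R S ` J) = {fr a u | a u. a \<in> J \<and> u \<in> S}" (is "_ = ?E")
proof -
  interpret J: ideal J R by fact
  interpret L: cring L by (rule localization_cring)
  have Jc: "a \<in> J \<Longrightarrow> a \<in> carrier R" for a by auto
  have E: "ideal ?E L"
  proof (rule idealI[OF L.ring_axioms])
    show "subgroup ?E (add_monoid L)"
    proof (rule L.add.subgroupI)
      show "?E \<subseteq> carrier L" using frac_carr Jc by auto
      show "?E \<noteq> {}" using S_one J.zero_closed by blast
    next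
      fix x assume "x \<in> ?E"
      then obtain a u where x: "x = fr a u" "a \<in> J" "u \<in> S" by blast
      have e: "u \<otimes> \<ominus> a \<oplus> u \<otimes> a = \<zero>" using Jc[OF x(2)] S_carr[OF x(3)] by (simp add: a_minus_def r_distr l_distr r_minus l_minus minus_add r_neg l_neg r_neg1 r_neg2 a_ac m_ac)
      have "fr (\<ominus> a) u \<oplus>\<^bsub>L\<^esub> x = fr \<zero> (u \<otimes> u)" using x Jc e by (simp add: add_frac)
      also have "\<dots> = \<zero>\<^bsub>L\<^esub>" unfolding L_carrier(3)
        by (rule frac_eqI) (use x S_mult S_one S_carr[of u] S_carr[of "u \<otimes> u"] in simp_all)
      finally have "\<ominus>\<^bsub>L\<^esub> x = fr (\<ominus> a) u"
        using L.minus_equality[of "fr (\<ominus> a) u" x] x Jc frac_carr by simp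
      moreover have "\<ominus> a \<in> J" using x by simp
      ultimately show "\<ominus>\<^bsub>L\<^esub> x \<in> ?E" using x by blast
    next
      fix x y assume "x \<in> ?E" "y \<in> ?E"
      then obtain a u b v where x: "x = fr a u" "a \<in> J" "u \<in> S" "y = fr b v" "b \<in> J" "v \<in> S" by blast
      then have "x \<oplus>\<^bsub>L\<^esub> y = fr (v \<otimes> a \<oplus> u \<otimes> b) (u \<otimes> v)" using Jc by (simp add: add_frac)
      moreover have "v \<otimes> a \<oplus> u \<otimes> b \<in> J" using x S_carr by (simp add: J.I_l_closed)
      ultimately show "x \<oplus>\<^bsub>L\<^esub> y \<in> ?E" using S_mult[OF x(3,6)] by auto
    qed
  next
    fix x y assume xy: "x \<in> ?E" "y \<in> carrier L"
    then obtain a u where x: "x = fr a u" "a \<in> J" "u \<in> S" by blast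
    obtain b v where y: "y = fr b v" "b \<in> carrier R" "v \<in> S" "v \<in> carrier R" using L_cases[OF xy(2)] by blast
    have "x \<otimes>\<^bsub>L\<^esub> y = fr (a \<otimes> b) (u \<otimes> v)" using x y Jc by (simp add: mult_frac)
    moreover have "a \<otimes> b \<in> J" using x y by (simp add: J.I_r_closed)
    ultimately have xyE: "x \<otimes>\<^bsub>L\<^esub> y \<in> ?E" using S_mult x y by blast
    then show "x \<otimes>\<^bsub>L\<^esub> y \<in> ?E" .
    have "y \<otimes>\<^bsub>L\<^esub> x = x \<otimes>\<^bsub>L\<^esub> y" using L.m_comm xy(2) x Jc frac_carr by simp
    with xyE show "y \<otimes>\<^bsub>L\<^esub> x \<in> ?E" by simp
  qed
  have sub: "localization_map R S ` J \<subseteq> ?E" using S_one by (auto simp: localization_map_def)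
  have sc: "localization_map R S ` J \<subseteq> carrier L" using S_one Jc frac_carr by (auto simp: localization_map_def)
  interpret G: ideal "genideal L (localization_map R S ` J)" L using L.genideal_ideal[OF sc] .
  show ?thesis
  proof
    show "genideal L (localization_map R S ` J) \<subseteq> ?E" using L.genideal_minimal[OF E sub] .
    show "?E \<subseteq> genideal L (localization_map R S ` J)"
    proof
      fix x assume "x \<in> ?E"
      then obtain a u where x: "x = fr a u" "a \<in> J" "u \<in> S" by blast
      have "x = fr \<one> u \<otimes>\<^bsub>L\<^esub> fr a \<one>" using x Jc S_one S_carr by (simp add: mult_frac)
      moreover have "fr a \<one> \<in> genideal L (localization_map R S ` J)"
        using L.genideal_self[OF sc] x by (auto simp: localization_map_def)
      ultimately show "x \<in> genideal L (localization_map R S ` J)"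
        using G.I_l_closed frac_carr x by simp
    qed
  qed
qed

lemma (in cring) local_contraction_iff:
  assumes P: "primeideal P R" and J: "ideal J R"
  shows "f \<in> local_contraction R P J \<longleftrightarrow> f \<in> carrier R \<and> (\<exists>u\<in>carrier R - P. u \<otimes> f \<in> J)"
proof -
  let ?S = "carrier R - P"
  interpret mult_subset R ?S by (rule mult_subset_prime[OF P])
  interpret J: ideal J R by fact
  have Jc: "a \<in> J \<Longrightarrow> a \<in> carrier R" for a by auto
  show ?thesis
  proof
    assume "f \<in> local_contraction R P J"
    then have f: "f \<in> carrier R" and "loc_frac R ?S f \<one> \<in> {loc_frac R ?S a u | a u. a \<in> J \<and> u \<in> ?S}"
      unfolding local_contraction_def ideal_extension[OF J] by (auto simp: localization_map_def)
    then obtain a u where a: "a \<in> J" "u \<in> ?S" "loc_frac R ?S f \<one> = loc_frac R ?S a u" by blast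
    then have "frac_rel f \<one> a u" using frac_eq_iff[OF f Jc[OF a(1)] S_one a(2)] by simp
    then obtain w where w: "w \<in> ?S" "w \<otimes> (u \<otimes> f \<ominus> \<one> \<otimes> a) = \<zero>" unfolding frac_rel_def by blast
    have c: "u \<in> carrier R" "w \<in> carrier R" "a \<in> carrier R" using a w by auto
    have "(w \<otimes> u) \<otimes> f = w \<otimes> (u \<otimes> f \<ominus> \<one> \<otimes> a) \<oplus> w \<otimes> a" using c f by (simp add: a_minus_def r_distr l_distr r_minus l_minus minus_add r_neg l_neg r_neg1 r_neg2 a_ac m_ac)
    also have "\<dots> = w \<otimes> a" using w c by simp
    finally have "(w \<otimes> u) \<otimes> f \<in> J" using a c J.I_l_closed by simp
    then show "f \<in> carrier R \<and> (\<exists>u\<in>?S. u \<otimes> f \<in> J)" using S_mult[OF w(1) a(2)] f by blast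
  next
    assume "f \<in> carrier R \<and> (\<exists>u\<in>?S. u \<otimes> f \<in> J)"
    then obtain u where f: "f \<in> carrier R" and u: "u \<in> ?S" "u \<otimes> f \<in> J" by blast
    have "loc_frac R ?S f \<one> = loc_frac R ?S (u \<otimes> f) u"
      by (rule frac_eqI) (use f u S_one in auto)
    then show "f \<in> local_contraction R P J"
      unfolding local_contraction_def ideal_extension[OF J] using f u by (auto simp: localization_map_def)
  qed
qed

lemma (in cring) quot_module_smult:
  assumes "ideal N R" "a \<in> carrier R" "f \<in> carrier R"
  shows "a \<odot>\<^bsub>quot_module R M N\<^esub> (N +> f) = N +> (a \<otimes> f)"
proof -
  interpret N: ideal N R by fact
  have "N +> (a \<otimes> x) = N +> (a \<otimes> f)" if x: "x \<in> N +> f" for x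
  proof -
    obtain h where h: "h \<in> N" "x = h \<oplus> f" using x unfolding a_r_coset_def' by blast
    have "a \<otimes> x = (a \<otimes> h) \<oplus> (a \<otimes> f)" using h assms by (simp add: r_distr)
    moreover have "a \<otimes> h \<in> N" using h assms by (simp add: N.I_l_closed)
    ultimately have "a \<otimes> x \<in> N +> (a \<otimes> f)" by (auto simp: a_r_coset_def')
    then show ?thesis using N.a_repr_independence'[of "a \<otimes> x" "a \<otimes> f"] assms by simp
  qed
  moreover have "f \<in> N +> f" using assms N.a_rcos_self by simp
  ultimately have "(\<Union>x\<in>N +> f. N +> (a \<otimes> x)) = N +> (a \<otimes> f)" by blast
  then show ?thesis by (simp add: quot_module_def)
qed

lemma (in cring) Ass_eq:
  assumes I: "ideal I R"
  shows "Ass R I = {P. primeideal P R \<and> (\<exists>f\<in>carrier R. P = {a \<in> carrier R. a \<otimes> f \<in> I})}"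
proof -
  interpret I: ideal I R by fact
  have z: "I +> g = I \<longleftrightarrow> g \<in> I" if "g \<in> carrier R" for g
    using that I.a_rcos_self[OF that] I.a_rcos_const by auto
  let ?Q = "quot_module R (carrier R) I"
  have z0: "\<zero>\<^bsub>?Q\<^esub> = I" by (simp add: quot_module_def)
  have "{a \<in> carrier R. a \<odot>\<^bsub>?Q\<^esub> (I +> f) = \<zero>\<^bsub>?Q\<^esub>} = {a \<in> carrier R. a \<otimes> f \<in> I}"
    if "f \<in> carrier R" for f
    unfolding z0 by (rule Collect_cong) (use that in \<open>simp add: quot_module_smult[OF I] z cong: conj_cong\<close>)
  moreover have "carrier ?Q = (\<lambda>f. I +> f) ` carrier R" by (auto simp: quot_module_def)
  ultimately show ?thesis
    by (simp add: Ass_def associated_primes_def)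
qed

end

theory Submission
  imports Defs
begin

text \<open>
  Write \<open>c\<close> for the product of the variables on the cycle.

  Localizing at the prime of a minimal vertex cover \<open>W\<close> shows that every monomial of an element of
  \<open>I\<^sup>(\<^sup>s\<^sup>)\<close> has degree at least \<open>s\<close> in the variables of \<open>W\<close>. If every vertex is in the closed
  neighbourhood of the cycle, then the graph is the cycle with leaves attached to it, and an integral
  min-max argument shows that such a monomial is divisible by \<open>c\<^sup>j\<close> times a product of \<open>q\<close> edges with
  \<open>j(n + 1) + q \<ge> s\<close>. Multiplying \<open>c\<close> with a variable adjacent to the cycle gives a product of \<open>n + 1\<close>
  edges, so \<open>k\<close> variables repair \<open>k\<close> factors \<open>c\<close>; further factors \<open>c\<close> are not needed, since
  \<open>c \<in> I\<^sup>n\<close> already makes up for \<open>r \<le> n\<close>.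

  Conversely \<open>c\<^sup>k e\<^sup>r\<close>, where \<open>e\<close> is an edge of the cycle, is in \<open>I\<^sup>(\<^sup>s\<^sup>)\<close> because each associated prime
  misses a variable adjacent to the cycle, but its degree is \<open>2s - k\<close>. The variables of
  vertices outside of the closed neighbourhood of the cycle do not help to form edges.
\<close>

section \<open>Monomial ideals\<close>

abbreviation keys where "keys \<equiv> Poly_Mapping.keys"
abbreviation lookup where "lookup \<equiv> Poly_Mapping.lookup"

lemma vpoly_ring_simps [simp]:
  "carrier (vpoly_ring :: ('v, 'k::field) vpoly ring) = UNIV"
  "(f :: ('v, 'k) vpoly) \<otimes>\<^bsub>vpoly_ring\<^esub> g = f * g"
  "f \<oplus>\<^bsub>vpoly_ring\<^esub> g = f + g"
  "\<zero>\<^bsub>vpoly_ring\<^esub> = (0 :: ('v, 'k) vpoly)"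
  "\<one>\<^bsub>vpoly_ring\<^esub> = (1 :: ('v, 'k) vpoly)"
  by (simp_all add: ring_of_type_algebra_def)

lemma cring_vpoly_ring: "cring (vpoly_ring :: ('v, 'k::field) vpoly ring)"
  by (rule cring_from_type_algebra)

lemma ring_vpoly_ring: "ring (vpoly_ring :: ('v, 'k::field) vpoly ring)"
  by (rule ring_from_type_algebra)

section \<open>Exponent sets and their sumsets\<close>

definition upclosed :: "('v \<Rightarrow>\<^sub>0 nat) set \<Rightarrow> bool" where
  "upclosed U \<longleftrightarrow> (\<forall>a\<in>U. \<forall>b. a + b \<in> U)"

text \<open>For an up-closed \<open>U\<close> this is the ideal spanned by the monomials with
  exponent in \<open>U\<close>; products and powers of such ideals become sumsets of
  exponents.\<close>

definition monomial_ideal :: "('v \<Rightarrow>\<^sub>0 nat) set \<Rightarrow> ('v, 'k::field) vpoly set" where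
  "monomial_ideal U = {f. keys f \<subseteq> U}"

definition sumset :: "('v \<Rightarrow>\<^sub>0 nat) set \<Rightarrow> ('v \<Rightarrow>\<^sub>0 nat) set \<Rightarrow> ('v \<Rightarrow>\<^sub>0 nat) set" where
  "sumset U V = {a + b | a b. a \<in> U \<and> b \<in> V}"

text \<open>At 0 the value is \<open>UNIV\<close> because the zeroth power is the unit
  ideal.\<close>

primrec iterated_sumset :: "('v \<Rightarrow>\<^sub>0 nat) set \<Rightarrow> nat \<Rightarrow> ('v \<Rightarrow>\<^sub>0 nat) set" where
  "iterated_sumset U 0 = UNIV"
| "iterated_sumset U (Suc s) = sumset (iterated_sumset U s) U"

lemma upclosedD: "upclosed U \<Longrightarrow> a \<in> U \<Longrightarrow> a + b \<in> U"
  by (simp add: upclosed_def)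

lemma add_diff_exponent:
  fixes a m :: "'v \<Rightarrow>\<^sub>0 nat"
  assumes "\<And>v. lookup a v \<le> lookup m v"
  shows "a + (m - a) = m"
  by (rule poly_mapping_eqI) (use assms in \<open>simp add: lookup_add lookup_minus\<close>)

lemma upclosed_mono:
  assumes "upclosed U" "a \<in> U" "\<And>v. lookup a v \<le> lookup m v"
  shows "m \<in> U"
  using upclosedD[OF assms(1,2), of "m - a"] add_diff_exponent[OF assms(3)] by simp

lemma upclosed_sumset: "upclosed V \<Longrightarrow> upclosed (sumset U V)"
  unfolding upclosed_def sumset_def by (auto simp: add.assoc) metis

lemma upclosed_iterated_sumset: "upclosed U \<Longrightarrow> upclosed (iterated_sumset U s)"
  by (cases s) (simp_all add: upclosed_sumset, simp add: upclosed_def)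

lemma sumsetI: "a \<in> U \<Longrightarrow> b \<in> V \<Longrightarrow> a + b \<in> sumset U V"
  unfolding sumset_def by blast

lemma iterated_sumset_add:
  assumes "upclosed U" "a \<in> iterated_sumset U s" "b \<in> iterated_sumset U t"
  shows "a + b \<in> iterated_sumset U (s + t)"
  using assms(3)
proof (induction t arbitrary: b)
  case 0
  show ?case using upclosedD[OF upclosed_iterated_sumset[OF assms(1)] assms(2)] by simp
next
  case (Suc t)
  then obtain p q where "b = p + q" "p \<in> iterated_sumset U t" "q \<in> U"
    by (auto simp: sumset_def)
  then show ?case using sumsetI[OF Suc.IH[of p], of q U] by (simp add: add.assoc)
qed

lemma iterated_sumset_Suc_subset: "upclosed U \<Longrightarrow> iterated_sumset U (Suc s) \<subseteq> iterated_sumset U s"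
  using upclosedD[OF upclosed_iterated_sumset] by (fastforce simp: sumset_def)

lemma iterated_sumset_antimono:
  assumes "upclosed U" "s \<le> t"
  shows "iterated_sumset U t \<subseteq> iterated_sumset U s"
  using assms(2) by (induction t rule: dec_induct) (use iterated_sumset_Suc_subset[OF assms(1)] in blast)+

lemma iterated_sumset_mult:
  assumes "upclosed U" "a \<in> iterated_sumset U t"
  shows "(\<Sum>i<(j::nat). a) \<in> iterated_sumset U (j * t)"
proof (induction j)
  case (Suc j)
  show ?case using iterated_sumset_add[OF assms(1) Suc assms(2)] by (simp add: add.commute)
qed simp

lemma lookup_copies: "lookup (\<Sum>i<(j::nat). (a :: 'v \<Rightarrow>\<^sub>0 nat)) v = j * lookup a v"
  by (simp add: lookup_sum)

section \<open>Ideals of polynomials described by exponents\<close>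

lemma poly_mapping_expand:
  "(f :: ('v, 'k::field) vpoly) = (\<Sum>a\<in>keys f. Poly_Mapping.single 0 (lookup f a) * Poly_Mapping.single a 1)"
proof (rule poly_mapping_eqI)
  fix k
  have "lookup (\<Sum>a\<in>keys f. Poly_Mapping.single 0 (lookup f a) * Poly_Mapping.single a 1) k
    = (\<Sum>a\<in>keys f. if a = k then lookup f a else 0)"
    by (simp add: lookup_sum mult_single lookup_single when_def)
  also have "\<dots> = lookup f k" by (simp add: in_keys_iff)
  finally show "lookup f k = lookup (\<Sum>a\<in>keys f. Poly_Mapping.single 0 (lookup f a) * Poly_Mapping.single a 1) k" ..
qed

lemma ideal_sum:
  assumes "ideal J (vpoly_ring :: ('v, 'k::field) vpoly ring)" "finite A" "\<And>a. a \<in> A \<Longrightarrow> f a \<in> J"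
  shows "sum f A \<in> J"
proof -
  note J = ideal.axioms(1)[OF assms(1)]
  show ?thesis using assms(2,3)
    by (induction rule: finite_induct)
      (use additive_subgroup.zero_closed[OF J] additive_subgroup.a_closed[OF J] in auto)
qed

lemma ideal_monomial_ideal:
  assumes "upclosed U"
  shows "ideal (monomial_ideal U) (vpoly_ring :: ('v, 'k::field) vpoly ring)" (is "ideal ?M _")
proof (rule idealI[OF ring_vpoly_ring])
  interpret R: cring "vpoly_ring :: ('v, 'k) vpoly ring" by (rule cring_vpoly_ring)
  show "subgroup ?M (add_monoid vpoly_ring)"
  proof (rule R.add.subgroupI)
    show "?M \<noteq> {}" by (auto simp: monomial_ideal_def intro: exI[of _ 0])
    fix f :: "('v, 'k) vpoly" assume f: "f \<in> ?M"
    have "\<ominus>\<^bsub>vpoly_ring\<^esub> f = - f" using R.minus_equality[of "- f" f] by simp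
    then show "\<ominus>\<^bsub>vpoly_ring\<^esub> f \<in> ?M" using f by (simp add: monomial_ideal_def)
    fix g :: "('v, 'k) vpoly" assume "g \<in> ?M"
    then show "f \<oplus>\<^bsub>vpoly_ring\<^esub> g \<in> ?M"
      using f keys_add[of f g] by (auto simp: monomial_ideal_def)
  qed simp
  fix f g :: "('v, 'k) vpoly" assume f: "f \<in> ?M"
  have "keys (f * g) \<subseteq> U"
    using keys_mult[of f g] f assms by (fastforce simp: monomial_ideal_def upclosed_def)
  then show "f \<otimes>\<^bsub>vpoly_ring\<^esub> g \<in> ?M" "g \<otimes>\<^bsub>vpoly_ring\<^esub> f \<in> ?M"
    by (simp_all add: monomial_ideal_def mult.commute)
qed

text \<open>The ideal absorbs the coefficients as constant factors, so having the monomials is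
  enough.\<close>

lemma monomial_ideal_subset:
  assumes J: "ideal J (vpoly_ring :: ('v, 'k::field) vpoly ring)"
    and "\<And>a. a \<in> U \<Longrightarrow> Poly_Mapping.single a 1 \<in> J"
  shows "monomial_ideal U \<subseteq> J"
proof
  fix f :: "('v, 'k) vpoly" assume f: "f \<in> monomial_ideal U"
  show "f \<in> J"
    by (subst poly_mapping_expand, rule ideal_sum[OF J finite_keys])
      (use f assms(2) ideal.I_l_closed[OF J] in \<open>force simp: monomial_ideal_def\<close>)
qed

lemma single_mem_monomial_ideal [simp]:
  "(Poly_Mapping.single a 1 :: ('v, 'k::field) vpoly) \<in> monomial_ideal U \<longleftrightarrow> a \<in> U"
  by (simp add: monomial_ideal_def)

lemma genideal_monomials:
  fixes A :: "('v \<Rightarrow>\<^sub>0 nat) set"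
  shows "genideal vpoly_ring {Poly_Mapping.single a 1 | a. a \<in> A}
    = (monomial_ideal (sumset A UNIV) :: ('v, 'k::field) vpoly set)" (is "genideal _ ?S = _")
proof
  interpret R: cring "vpoly_ring :: ('v, 'k) vpoly ring" by (rule cring_vpoly_ring)
  have up: "upclosed (sumset A UNIV)" by (rule upclosed_sumset) (simp add: upclosed_def)
  have "a \<in> sumset A UNIV" if "a \<in> A" for a using sumsetI[OF that, of 0 UNIV] by simp
  then show "genideal vpoly_ring ?S \<subseteq> (monomial_ideal (sumset A UNIV) :: ('v, 'k) vpoly set)"
    by (intro R.genideal_minimal ideal_monomial_ideal[OF up]) auto
  have G: "ideal (genideal vpoly_ring ?S) (vpoly_ring :: ('v, 'k) vpoly ring)"
    by (rule R.genideal_ideal) simp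
  have "Poly_Mapping.single (a + b) 1 \<in> (genideal vpoly_ring ?S :: ('v, 'k) vpoly set)" if "a \<in> A" for a b
  proof -
    have "Poly_Mapping.single a 1 \<in> (genideal vpoly_ring ?S :: ('v, 'k) vpoly set)"
      using R.genideal_self[of ?S] that by auto
    from ideal.I_r_closed[OF G this, of "Poly_Mapping.single b 1"] show ?thesis
      by (simp add: mult_single)
  qed
  then show "(monomial_ideal (sumset A UNIV) :: ('v, 'k) vpoly set) \<subseteq> genideal vpoly_ring ?S"
    by (intro monomial_ideal_subset[OF G]) (auto simp: sumset_def)
qed

text \<open>Cancellation only removes exponents of a product, which gives one inclusion; for the
  other, products of single monomials suffice.\<close>

lemma ideal_prod_monomial_ideal:
  assumes U: "upclosed U" and V: "upclosed V"
  shows "ideal_prod vpoly_ring (monomial_ideal U) (monomial_ideal V)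
    = (monomial_ideal (sumset U V) :: ('v, 'k::field) vpoly set)"
proof
  interpret R: cring "vpoly_ring :: ('v, 'k) vpoly ring" by (rule cring_vpoly_ring)
  note I = ideal_monomial_ideal[OF U, where 'k = 'k] ideal_monomial_ideal[OF V, where 'k = 'k]
  show "ideal_prod vpoly_ring (monomial_ideal U) (monomial_ideal V)
    \<subseteq> (monomial_ideal (sumset U V) :: ('v, 'k) vpoly set)"
  proof
    fix f :: "('v, 'k) vpoly"
    assume "f \<in> ideal_prod vpoly_ring (monomial_ideal U) (monomial_ideal V)"
    then show "f \<in> monomial_ideal (sumset U V)"
    proof induction
      case (prod i j)
      then show ?case using keys_mult[of i j] by (fastforce simp: monomial_ideal_def sumset_def)
    next
      case (sum i j)
      then show ?case using keys_add[of i j] by (auto simp: monomial_ideal_def)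
    qed
  qed
  have "Poly_Mapping.single (a + b) 1
      \<in> (ideal_prod vpoly_ring (monomial_ideal U) (monomial_ideal V) :: ('v, 'k) vpoly set)"
    if "a \<in> U" "b \<in> V" for a b
    using ideal_prod.prod[of "Poly_Mapping.single a 1" "monomial_ideal U" "Poly_Mapping.single b 1"
        "monomial_ideal V" "vpoly_ring :: ('v, 'k) vpoly ring"] that
    by (simp add: mult_single)
  then show "(monomial_ideal (sumset U V) :: ('v, 'k) vpoly set)
      \<subseteq> ideal_prod vpoly_ring (monomial_ideal U) (monomial_ideal V)"
    by (intro monomial_ideal_subset[OF R.ideal_prod_is_ideal[OF I]]) (auto simp: sumset_def)
qed

lemma ideal_pow_monomial_ideal:
  assumes U: "upclosed U"
  shows "ideal_pow vpoly_ring (monomial_ideal U) s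
    = (monomial_ideal (iterated_sumset U s) :: ('v, 'k::field) vpoly set)"
proof (induction s)
  case 0
  show ?case by (simp add: ideals_set_def monomial_ideal_def nat_pow_def)
next
  case (Suc s)
  have "ideal_pow vpoly_ring (monomial_ideal U) (Suc s) =
    ideal_prod vpoly_ring (ideal_pow vpoly_ring (monomial_ideal U) s)
      (monomial_ideal U :: ('v, 'k) vpoly set)"
    by (simp add: ideals_set_def nat_pow_def)
  then show ?case
    by (simp add: Suc ideal_prod_monomial_ideal[OF upclosed_iterated_sumset[OF U] U])
qed

section \<open>Exponents of the edge ideal and of the maximal ideal\<close>

lemma Var_mult_Var:
  "Var u * Var v = Poly_Mapping.single (Poly_Mapping.single u 1 + Poly_Mapping.single v 1) (1 :: 'k::field)"
  by (simp add: Var_def mult_single)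

definition edge_exponents :: "'v set set \<Rightarrow> ('v \<Rightarrow>\<^sub>0 nat) set" where
  "edge_exponents E =
     sumset {Poly_Mapping.single u 1 + Poly_Mapping.single v 1 | u v. {u, v} \<in> E} UNIV"

text \<open>The degree of the monomial in the variables of \<open>W\<close>; for
  \<open>W = UNIV\<close> the total degree.\<close>

definition weight :: "'v set \<Rightarrow> ('v \<Rightarrow>\<^sub>0 nat) \<Rightarrow> nat" where
  "weight W m = (\<Sum>v\<in>W. lookup m v)"

lemma weight_add: "weight W (a + b) = weight W a + weight W b"
  by (simp add: weight_def lookup_add sum.distrib)

lemma weight_sum: "weight W (sum f A) = (\<Sum>i\<in>A. weight W (f i))"
  by (induction A rule: infinite_finite_induct) (simp_all add: weight_add, simp_all add: weight_def)

lemma weight_single: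
  "finite W \<Longrightarrow> weight W (Poly_Mapping.single v j) = (if v \<in> W then j else 0)"
  by (simp add: weight_def lookup_single when_def)

lemma upclosed_edge_exponents: "upclosed (edge_exponents E)"
  unfolding edge_exponents_def by (rule upclosed_sumset) (simp add: upclosed_def)

lemma edge_ideal_eq: "edge_ideal E = (monomial_ideal (edge_exponents E) :: ('v, 'k::field) vpoly set)"
proof -
  have "{Var u * Var v | u v. {u, v} \<in> E} = {Poly_Mapping.single a (1 :: 'k) | a.
      a \<in> {Poly_Mapping.single u 1 + Poly_Mapping.single v 1 | u v. {u, v} \<in> E}}"
    by (auto simp: Var_mult_Var)
  then show ?thesis unfolding edge_ideal_def edge_exponents_def by (simp only: genideal_monomials)
qed

text \<open>The left side comes from the generators of the maximal ideal; the right side lets its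
  powers be read as degree bounds.\<close>

lemma exponents_weight_pos_eq:
  "sumset (range (\<lambda>v. Poly_Mapping.single v 1)) UNIV = {m :: 'v::finite \<Rightarrow>\<^sub>0 nat. 1 \<le> weight UNIV m}"
proof (intro Set.set_eqI iffI)
  fix m :: "'v \<Rightarrow>\<^sub>0 nat" assume "m \<in> {m. 1 \<le> weight UNIV m}"
  then obtain v where v: "0 < lookup m v" by (force simp: weight_def)
  have "Poly_Mapping.single v 1 + (m - Poly_Mapping.single v 1) = m"
    by (rule add_diff_exponent) (use v in \<open>auto simp: lookup_single when_def\<close>)
  then show "m \<in> sumset (range (\<lambda>v. Poly_Mapping.single v 1)) UNIV"
    using sumsetI[of "Poly_Mapping.single v 1" "range (\<lambda>v. Poly_Mapping.single v 1)" _ UNIV]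
    by (metis UNIV_I rangeI)
qed (auto simp: sumset_def weight_add weight_single)

lemma upclosed_weight_ge: "upclosed {m. s \<le> weight W m}"
  by (simp add: upclosed_def weight_add)

lemma iterated_sumset_weight_pos:
  "iterated_sumset {m :: 'v::finite \<Rightarrow>\<^sub>0 nat. 1 \<le> weight UNIV m} s = {m. s \<le> weight UNIV m}"
proof (induction s)
  case (Suc s)
  show ?case
  proof (intro Set.set_eqI iffI)
    fix m :: "'v \<Rightarrow>\<^sub>0 nat" assume m: "m \<in> {m. Suc s \<le> weight UNIV m}"
    then have "m \<in> sumset (range (\<lambda>v. Poly_Mapping.single v 1)) UNIV"
      unfolding exponents_weight_pos_eq by simp
    then obtain v b where b: "m = Poly_Mapping.single v 1 + b" by (auto simp: sumset_def)
    then have "b \<in> {m. s \<le> weight UNIV m}" using m by (simp add: weight_add weight_single)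
    then show "m \<in> iterated_sumset {m. 1 \<le> weight UNIV m} (Suc s)"
      using sumsetI[of b "{m. s \<le> weight UNIV m}" "Poly_Mapping.single v 1" "{m. 1 \<le> weight UNIV m}"]
      by (simp add: Suc[simplified] weight_single b add.commute)
  qed (auto simp: Suc[simplified] sumset_def weight_add)
qed simp

lemma max_ideal_pow_eq:
  "ideal_pow vpoly_ring max_ideal j
    = (monomial_ideal {m. j \<le> weight UNIV m} :: ('v::finite, 'k::field) vpoly set)"
proof -
  have "range Var = {Poly_Mapping.single a (1 :: 'k) | a. a \<in> range (\<lambda>v::'v. Poly_Mapping.single v 1)}"
    by (auto simp: Var_def)
  then have "(max_ideal :: ('v, 'k) vpoly set) = monomial_ideal {m. 1 \<le> weight UNIV m}"
    unfolding max_ideal_def by (simp only: genideal_monomials exponents_weight_pos_eq)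
  then show ?thesis
    using ideal_pow_monomial_ideal[OF upclosed_weight_ge[of 1 "UNIV :: 'v set"], of j, where 'k = 'k]
    unfolding iterated_sumset_weight_pos by simp
qed

abbreviation edge_products :: "'v set set \<Rightarrow> nat \<Rightarrow> ('v \<Rightarrow>\<^sub>0 nat) set" where
  "edge_products E \<equiv> iterated_sumset (edge_exponents E)"

lemma edge_ideal_pow_eq:
  "ideal_pow vpoly_ring (edge_ideal E) s = (monomial_ideal (edge_products E s) :: ('v, 'k::field) vpoly set)"
  by (simp only: edge_ideal_eq ideal_pow_monomial_ideal[OF upclosed_edge_exponents])

lemma ideal_edge_ideal_pow:
  "ideal (ideal_pow vpoly_ring (edge_ideal E) s) (vpoly_ring :: ('v, 'k::field) vpoly ring)"
  by (simp only: edge_ideal_pow_eq ideal_monomial_ideal upclosed_iterated_sumset upclosed_edge_exponents)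

lemma edge_mem_edge_products:
  assumes "{u, v} \<in> E"
  shows "Poly_Mapping.single u 1 + Poly_Mapping.single v 1 \<in> edge_products E 1"
proof -
  have "Poly_Mapping.single u 1 + Poly_Mapping.single v 1 + 0 \<in> edge_exponents E"
    unfolding edge_exponents_def by (rule sumsetI) (use assms in auto)
  then show ?thesis using sumsetI[of 0 UNIV _ "edge_exponents E"] by simp
qed

definition vertex_cover :: "'v set set \<Rightarrow> 'v set \<Rightarrow> bool" where
  "vertex_cover E W \<longleftrightarrow> (\<forall>u v. {u, v} \<in> E \<longrightarrow> u \<in> W \<or> v \<in> W)"

text \<open>Every edge factor has an end in the cover and so contributes at least 1.\<close>

lemma weight_edge_products:
  fixes W :: "'v::finite set"
  assumes "vertex_cover E W" "m \<in> edge_products E s"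
  shows "s \<le> weight W m"
  using assms(2)
proof (induction s arbitrary: m)
  case (Suc s)
  then obtain a u v b where "m = a + (Poly_Mapping.single u 1 + Poly_Mapping.single v 1 + b)"
    "a \<in> edge_products E s" "{u, v} \<in> E"
    by (auto simp: sumset_def edge_exponents_def)
  moreover have "1 \<le> weight W (Poly_Mapping.single u 1) + weight W (Poly_Mapping.single v 1)"
    using assms(1) calculation(3) by (auto simp: vertex_cover_def weight_single)
  ultimately show ?case using Suc.IH[of a] by (simp add: weight_add)
qed simp

section \<open>Symbolic powers of edge ideals\<close>

lemma lookup_times:
  fixes f g :: "('v, 'k::field) vpoly"
  shows "lookup (f * g) k = (\<Sum>a\<in>keys f. \<Sum>b\<in>keys g. if a + b = k then lookup f a * lookup g b else 0)"
proof -
  have "(h :: ('v, 'k) vpoly) = (\<Sum>a\<in>keys h. Poly_Mapping.single a (lookup h a))" for h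
    by (subst poly_mapping_expand) (simp add: mult_single)
  then have "f * g = (\<Sum>a\<in>keys f. Poly_Mapping.single a (lookup f a)) * (\<Sum>b\<in>keys g. Poly_Mapping.single b (lookup g b))"
    by presburger
  also have "\<dots> = (\<Sum>a\<in>keys f. \<Sum>b\<in>keys g. Poly_Mapping.single (a + b) (lookup f a * lookup g b))"
    by (simp add: sum_product mult_single)
  finally have "f * g = \<dots>" .
  then show ?thesis by (simp add: lookup_sum lookup_single when_def)
qed

text \<open>Additivity leaves no slack: two elements with the same sum as two minimizers must both
  be minimizers. So a sum that is unique among the minimizers is unique altogether.\<close>

lemma minimizing_face:
  fixes \<phi> :: "'a::cancel_comm_monoid_add \<Rightarrow> nat"
  assumes add: "\<And>a b. \<phi> (a + b) = \<phi> a + \<phi> b" and "A \<noteq> {}" "B \<noteq> {}"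
  defines "F \<equiv> \<lambda>A. {a\<in>A. \<forall>x\<in>A. \<phi> a \<le> \<phi> x}"
  shows "F A \<noteq> {}" "F B \<noteq> {}"
    and "\<lbrakk>a \<in> F A; b \<in> F B; a' \<in> A; b' \<in> B; a' + b' = a + b\<rbrakk> \<Longrightarrow> a' \<in> F A \<and> b' \<in> F B"
proof -
  have ne: "F C \<noteq> {}" if "C \<noteq> {}" for C
    using that ex_has_least_nat[of "\<lambda>x. x \<in> C" _ \<phi>] unfolding F_def by blast
  show "F A \<noteq> {}" "F B \<noteq> {}" using ne assms by blast+
  assume h: "a \<in> F A" "b \<in> F B" "a' \<in> A" "b' \<in> B" "a' + b' = a + b"
  have "\<phi> a' + \<phi> b' = \<phi> a + \<phi> b" using h(5) add by metis
  moreover have "\<phi> a \<le> \<phi> a'" "\<phi> b \<le> \<phi> b'" using h unfolding F_def by blast+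
  ultimately have "\<phi> a' = \<phi> a" "\<phi> b' = \<phi> b" by linarith+
  with h show "a' \<in> F A \<and> b' \<in> F B" unfolding F_def by simp
qed

text \<open>Minimizing one coordinate after another plays the role of a monomial order: each step
  fixes one more coordinate, until both sets are singletons.\<close>

lemma unique_sum_coordinates:
  fixes A B :: "('v \<Rightarrow>\<^sub>0 nat) set"
  assumes "finite V" "A \<noteq> {}" "B \<noteq> {}"
    and "\<And>a a' v. \<lbrakk>a \<in> A; a' \<in> A; v \<notin> V\<rbrakk> \<Longrightarrow> lookup a v = lookup a' v"
    and "\<And>b b' v. \<lbrakk>b \<in> B; b' \<in> B; v \<notin> V\<rbrakk> \<Longrightarrow> lookup b v = lookup b' v"
  shows "\<exists>a\<in>A. \<exists>b\<in>B. \<forall>a'\<in>A. \<forall>b'\<in>B. a' + b' = a + b \<longrightarrow> a' = a \<and> b' = b"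
  using assms
proof (induction V arbitrary: A B rule: finite_induct)
  case empty
  have "a = a'" if "a \<in> A" "a' \<in> A" for a a' by (rule poly_mapping_eqI) (use empty that in blast)
  moreover have "b = b'" if "b \<in> B" "b' \<in> B" for b b' by (rule poly_mapping_eqI) (use empty that in blast)
  ultimately show ?case using empty(1,2) by blast
next
  case (insert v V)
  define F where "F A = {a\<in>A. \<forall>x\<in>A. lookup a v \<le> lookup x v}" for A :: "('v \<Rightarrow>\<^sub>0 nat) set"
  have agree: "lookup a u = lookup a' u"
    if "\<And>a a' v'. \<lbrakk>a \<in> C; a' \<in> C; v' \<notin> insert v V\<rbrakk> \<Longrightarrow> lookup a v' = lookup a' v'"
      "a \<in> F C" "a' \<in> F C" "u \<notin> V" for C a a' u
  proof (cases "u = v")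
    case True
    then show ?thesis using that(2,3) unfolding F_def by (auto intro: antisym)
  next
    case False
    then show ?thesis using that unfolding F_def by simp
  qed
  note face = minimizing_face[of "\<lambda>a. lookup a v" A B, OF lookup_add insert.prems(1,2), folded F_def]
  have "\<exists>a\<in>F A. \<exists>b\<in>F B. \<forall>a'\<in>F A. \<forall>b'\<in>F B. a' + b' = a + b \<longrightarrow> a' = a \<and> b' = b"
    by (rule insert.IH[OF face(1,2)])
      (rule agree[OF insert.prems(3)], assumption+, rule agree[OF insert.prems(4)], assumption+)
  then obtain a b where ab: "a \<in> F A" "b \<in> F B"
    "\<And>a' b'. \<lbrakk>a' \<in> F A; b' \<in> F B; a' + b' = a + b\<rbrakk> \<Longrightarrow> a' = a \<and> b' = b" by blast
  have "a' = a \<and> b' = b" if "a' \<in> A" "b' \<in> B" "a' + b' = a + b" for a' b'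
    using ab(3) face(3)[OF ab(1,2) that] that by blast
  then show ?case using ab(1,2) unfolding F_def by blast
qed

text \<open>Minimize the weight first and then the coordinates: the resulting pair is the only one
  contributing to its product exponent, so its term cannot cancel.\<close>

lemma lowest_term:
  fixes f g :: "('v::finite, 'k::field) vpoly"
  assumes "f \<noteq> 0" "g \<noteq> 0"
  obtains a b where "a \<in> keys f" "b \<in> keys g" "a + b \<in> keys (f * g)"
    "\<And>x. x \<in> keys f \<Longrightarrow> weight W a \<le> weight W x" "\<And>x. x \<in> keys g \<Longrightarrow> weight W b \<le> weight W x"
proof -
  define F where "F A = {a\<in>A. \<forall>x\<in>A. weight W a \<le> weight W x}" for A :: "('v \<Rightarrow>\<^sub>0 nat) set"
  have ne: "keys f \<noteq> {}" "keys g \<noteq> {}" using assms by (auto simp: poly_mapping_eq_iff fun_eq_iff in_keys_iff)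
  note face = minimizing_face[of "weight W" "keys f" "keys g", OF weight_add ne, folded F_def]
  obtain a b where ab: "a \<in> F (keys f)" "b \<in> F (keys g)"
    "\<forall>a'\<in>F (keys f). \<forall>b'\<in>F (keys g). a' + b' = a + b \<longrightarrow> a' = a \<and> b' = b"
    using unique_sum_coordinates[of UNIV "F (keys f)" "F (keys g)"] face(1,2) by auto
  have uniq: "a' + b' = a + b \<longleftrightarrow> a' = a \<and> b' = b" if "a' \<in> keys f" "b' \<in> keys g" for a' b'
    using ab(3) face(3)[OF ab(1,2) that] by blast
  have k: "a \<in> keys f" "b \<in> keys g" using ab unfolding F_def by simp_all
  have "lookup (f * g) (a + b) =
      (\<Sum>a'\<in>keys f. \<Sum>b'\<in>keys g. if a' = a then if b' = b then lookup f a * lookup g b else 0 else 0)"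
    unfolding lookup_times by (intro sum.cong refl) (auto simp: uniq)
  also have "\<dots> = (\<Sum>a'\<in>keys f. if a' = a then lookup f a * lookup g b else 0)"
    by (intro sum.cong refl) (use k in \<open>auto simp: sum.delta\<close>)
  also have "\<dots> = lookup f a * lookup g b" using k by simp
  also have "\<dots> \<noteq> 0" using k by (simp add: in_keys_iff)
  finally have "a + b \<in> keys (f * g)" by (simp add: in_keys_iff)
  with that k ab show ?thesis unfolding F_def by blast
qed

section \<open>Supports, vertex covers and associated primes\<close>

lemma keys_times_monomial:
  "keys ((f :: ('v, 'k::field) vpoly) * Poly_Mapping.single m 1) = (\<lambda>a. a + m) ` keys f"
proof -
  have "lookup (f * Poly_Mapping.single m 1) k = (\<Sum>a\<in>keys f. if a + m = k then lookup f a else 0)" for k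
    by (simp add: lookup_times cong: if_cong)
  moreover have "(\<Sum>a\<in>keys f. if a + m = k then lookup f a else 0) =
      (if k \<in> (\<lambda>a. a + m) ` keys f then lookup f (k - m) else 0)" for k
  proof (cases "k \<in> (\<lambda>a. a + m) ` keys f")
    case True
    then obtain x where x: "x \<in> keys f" "k = x + m" by blast
    then have "(\<Sum>a\<in>keys f. if a + m = k then lookup f a else 0) = (\<Sum>a\<in>keys f. if a = x then lookup f a else 0)"
      by (intro sum.cong) auto
    then show ?thesis using x by simp
  qed (auto intro!: sum.neutral)
  ultimately show ?thesis
    by (auto simp: in_keys_iff split: if_splits)
qed

text \<open>Without loops an edge monomial is squarefree, so divisibility by it depends on the
  support only.\<close>

lemma mem_edge_exponents:
  assumes "simple_graph E"
  shows "m \<in> edge_exponents E \<longleftrightarrow> (\<exists>p q. {p, q} \<in> E \<and> 0 < lookup m p \<and> 0 < lookup m q)"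
proof
  assume "m \<in> edge_exponents E"
  then show "\<exists>p q. {p, q} \<in> E \<and> 0 < lookup m p \<and> 0 < lookup m q"
    by (force simp: edge_exponents_def sumset_def lookup_add)
next
  assume "\<exists>p q. {p, q} \<in> E \<and> 0 < lookup m p \<and> 0 < lookup m q"
  then obtain p q where e: "{p, q} \<in> E" "0 < lookup m p" "0 < lookup m q" by blast
  have "p \<noteq> q" using assms e(1) by (auto simp: simple_graph_def)
  have "Poly_Mapping.single p 1 + Poly_Mapping.single q 1 + 0 \<in> edge_exponents E"
    unfolding edge_exponents_def by (rule sumsetI) (use e in auto)
  then show "m \<in> edge_exponents E"
    by (rule upclosed_mono[OF upclosed_edge_exponents])
      (use e \<open>p \<noteq> q\<close> in \<open>auto simp: lookup_add lookup_single when_def\<close>)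
qed

text \<open>Minimality is expressed by an edge leaving the cover at each of its vertices, the form
  in which it yields an associated prime.\<close>

definition minimal_vertex_cover :: "'v set set \<Rightarrow> 'v set \<Rightarrow> bool" where
  "minimal_vertex_cover E W \<longleftrightarrow> vertex_cover E W \<and> (\<forall>w\<in>W. \<exists>u. u \<notin> W \<and> {w, u} \<in> E)"

text \<open>A cover of least size inside \<open>W\<close> works, because a vertex without an edge
  leaving the cover could be dropped.\<close>

lemma minimal_vertex_cover_exists:
  fixes E :: "'v::finite set set"
  assumes "simple_graph E" "vertex_cover E W"
  obtains W' where "minimal_vertex_cover E W'" "W' \<subseteq> W"
proof -
  obtain W' where W': "vertex_cover E W'" "W' \<subseteq> W"
    "\<And>V. vertex_cover E V \<and> V \<subseteq> W \<Longrightarrow> card W' \<le> card V"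
    using ex_has_least_nat[of "\<lambda>V. vertex_cover E V \<and> V \<subseteq> W" W card] assms(2) by blast
  have "\<exists>u. u \<notin> W' \<and> {w, u} \<in> E" if w: "w \<in> W'" for w
  proof (rule ccontr)
    assume n: "\<nexists>u. u \<notin> W' \<and> {w, u} \<in> E"
    have "vertex_cover E (W' - {w})"
      unfolding vertex_cover_def
    proof (intro allI impI)
      fix u v assume e: "{u, v} \<in> E"
      then have "u \<noteq> v" using assms(1) by (auto simp: simple_graph_def)
      then show "u \<in> W' - {w} \<or> v \<in> W' - {w}"
        using W'(1) n e unfolding vertex_cover_def by (metis DiffI insert_commute singletonD)
    qed
    then have "card W' \<le> card (W' - {w})" using W' by auto
    then show False using w by (metis card_Diff1_less finite leD)
  qed
  with that W' show ?thesis unfolding minimal_vertex_cover_def by blast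
qed

text \<open>The ideal generated by the variables of \<open>W\<close>.\<close>

abbreviation cover_ideal :: "'v set \<Rightarrow> ('v, 'k::field) vpoly set" where
  "cover_ideal W \<equiv> monomial_ideal {m. 1 \<le> weight W m}"

lemma not_mem_cover_ideal:
  assumes "f \<notin> cover_ideal W"
  obtains x where "x \<in> keys f" "weight W x = 0"
  using assms by (force simp: monomial_ideal_def)

text \<open>If each factor has a term of weight 0, then the lowest terms of the factors multiply to
  a surviving term of weight 0.\<close>

lemma primeideal_cover_ideal:
  "primeideal (cover_ideal W) (vpoly_ring :: ('v::finite, 'k::field) vpoly ring)"
proof (rule primeidealI[OF ideal_monomial_ideal[OF upclosed_weight_ge] cring_vpoly_ring])
  have "(1 :: ('v, 'k) vpoly) \<notin> cover_ideal W"
    by (simp add: monomial_ideal_def weight_def)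
  then show "carrier vpoly_ring \<noteq> (cover_ideal W :: ('v, 'k) vpoly set)" by auto
  fix f g :: "('v, 'k) vpoly" assume "f \<otimes>\<^bsub>vpoly_ring\<^esub> g \<in> cover_ideal W"
  then have fg: "f * g \<in> cover_ideal W" by simp
  show "f \<in> cover_ideal W \<or> g \<in> cover_ideal W"
  proof (rule ccontr)
    assume n: "\<not> (f \<in> cover_ideal W \<or> g \<in> cover_ideal W)"
    then obtain x y where x: "x \<in> keys f" "weight W x = 0" and y: "y \<in> keys g" "weight W y = 0"
      using not_mem_cover_ideal by metis
    then have "f \<noteq> 0" "g \<noteq> 0" by auto
    then obtain a b where ab: "a + b \<in> keys (f * g)"
      "\<And>x. x \<in> keys f \<Longrightarrow> weight W a \<le> weight W x" "\<And>x. x \<in> keys g \<Longrightarrow> weight W b \<le> weight W x"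
      using lowest_term[of f g W] by metis
    have "weight W (a + b) = 0" using ab(2)[OF x(1)] ab(3)[OF y(1)] x y by (simp add: weight_add)
    then show False using ab(1) fg by (force simp: monomial_ideal_def)
  qed
qed

lemma ideal_edge_ideal: "ideal (edge_ideal E) (vpoly_ring :: ('v, 'k::field) vpoly ring)"
  by (simp only: edge_ideal_eq ideal_monomial_ideal upclosed_edge_exponents)

lemma Ass_edge_ideal:
  "P \<in> Ass vpoly_ring (edge_ideal E :: ('v, 'k::field) vpoly set) \<longleftrightarrow>
     primeideal P vpoly_ring \<and> (\<exists>f. P = {a. a * f \<in> edge_ideal E})"
  by (simp add: cring.Ass_eq[OF cring_vpoly_ring ideal_edge_ideal])

lemma weight_edge_exponents:
  fixes W :: "'v::finite set"
  assumes "vertex_cover E W" "m \<in> edge_exponents E"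
  shows "1 \<le> weight W m"
  using weight_edge_products[OF assms(1), of "0 + m" 1] assms(2) sumsetI[of 0 UNIV m "edge_exponents E"]
  by simp

text \<open>The cover ideal is the annihilator of the product of the variables outside of the cover.\<close>

lemma cover_ideal_in_Ass:
  fixes E :: "'v::finite set set"
  assumes E: "simple_graph E" and W: "minimal_vertex_cover E W"
  shows "cover_ideal W \<in> Ass vpoly_ring (edge_ideal E :: ('v, 'k::field) vpoly set)"
proof -
  define m where "m = (\<Sum>v\<in>- W. Poly_Mapping.single v (1 :: nat))"
  have lm: "lookup m v = (if v \<in> W then 0 else 1)" for v
    by (simp add: m_def lookup_sum lookup_single when_def)
  have Wm: "weight W m = 0" by (simp add: weight_def lm)
  have "x + m \<in> edge_exponents E \<longleftrightarrow> 1 \<le> weight W x" for x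
  proof
    assume "x + m \<in> edge_exponents E"
    then show "1 \<le> weight W x"
      using W weight_edge_exponents[of E W "x + m"] Wm by (simp add: minimal_vertex_cover_def weight_add)
  next
    assume "1 \<le> weight W x"
    then have "\<exists>w\<in>W. 0 < lookup x w" by (rule contrapos_pp) (simp add: weight_def)
    then obtain w where w: "w \<in> W" "0 < lookup x w" by blast
    \<comment> \<open>Minimality provides \<open>u\<close> outside of \<open>W\<close>; its variable
      divides \<open>m\<close>, so \<open>x + m\<close> contains an edge.\<close>
    then obtain u where "u \<notin> W" "{w, u} \<in> E" using W by (auto simp: minimal_vertex_cover_def)
    with w show "x + m \<in> edge_exponents E"
      unfolding mem_edge_exponents[OF E] by (auto simp: lookup_add lm)
  qed
  then have "cover_ideal W = {a :: ('v, 'k) vpoly. a * Poly_Mapping.single m 1 \<in> edge_ideal E}"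
    by (auto simp: edge_ideal_eq monomial_ideal_def keys_times_monomial)
  then show ?thesis unfolding Ass_edge_ideal using primeideal_cover_ideal by blast
qed

lemma mem_local_contraction:
  assumes "primeideal P (vpoly_ring :: ('v, 'k::field) vpoly ring)"
  shows "f \<in> local_contraction vpoly_ring P (ideal_pow vpoly_ring (edge_ideal E) s) \<longleftrightarrow>
    (\<exists>u. u \<notin> P \<and> u * f \<in> monomial_ideal (edge_products E s))"
  using cring.local_contraction_iff[OF cring_vpoly_ring assms ideal_edge_ideal_pow[of E s]]
  by (auto simp: edge_ideal_pow_eq)

text \<open>A minimal cover inside \<open>W\<close> gives an associated prime, and an element
  outside of this prime has a term free of the cover variables. Multiplying \<open>f\<close> by that
  element leaves the least weight unchanged, and this is at least \<open>s\<close> in the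
  \<open>s\<close>-th power of the edge ideal.\<close>

theorem symbolic_power_weight:
  fixes f :: "('v::finite, 'k::field) vpoly"
  assumes E: "simple_graph E" and W: "vertex_cover E W"
    and f: "f \<in> symbolic_power vpoly_ring (edge_ideal E) s" and m: "m \<in> keys f"
  shows "s \<le> weight W m"
proof -
  obtain V where V: "minimal_vertex_cover E V" "V \<subseteq> W"
    by (rule minimal_vertex_cover_exists[OF E W])
  have "f \<in> local_contraction vpoly_ring (cover_ideal V) (ideal_pow vpoly_ring (edge_ideal E) s)"
    using f cover_ideal_in_Ass[OF E V(1), where 'k = 'k] by (simp add: symbolic_power_def)
  then obtain u where u: "u \<notin> cover_ideal V" "u * f \<in> monomial_ideal (edge_products E s)"
    unfolding mem_local_contraction[OF primeideal_cover_ideal] by blast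
  obtain x where x: "x \<in> keys u" "weight V x = 0" by (rule not_mem_cover_ideal[OF u(1)])
  have "u \<noteq> 0" "f \<noteq> 0" using x m by auto
  then obtain a b where ab: "a + b \<in> keys (u * f)"
    "\<And>x. x \<in> keys u \<Longrightarrow> weight V a \<le> weight V x" "\<And>x. x \<in> keys f \<Longrightarrow> weight V b \<le> weight V x"
    using lowest_term[of u f V] by metis
  have "a + b \<in> edge_products E s" using u(2) ab(1) by (auto simp: monomial_ideal_def)
  then have "s \<le> weight V (a + b)"
    using weight_edge_products V(1) by (auto simp: minimal_vertex_cover_def)
  also have "\<dots> \<le> weight V m" using ab(2)[OF x(1)] ab(3)[OF m] x(2) by (simp add: weight_add)
  also have "\<dots> \<le> weight W m" unfolding weight_def by (rule sum_mono2) (use V(2) in auto)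
  finally show ?thesis .
qed

text \<open>Write the prime as the annihilator of \<open>f\<close> modulo the edge ideal and take a
  term \<open>m\<close> of \<open>f\<close> outside of this ideal. If \<open>Var x\<close> lies in
  the prime, then \<open>m\<close> times \<open>Var x\<close> contains an edge, whose other end
  \<open>y\<close> divides \<open>m\<close>.\<close>

lemma Ass_edge_ideal_misses_variable:
  assumes E: "simple_graph E"
    and P: "P \<in> Ass vpoly_ring (edge_ideal E :: ('v::finite, 'k::field) vpoly set)"
  obtains y where "y = x \<or> {x, y} \<in> E" "Var y \<notin> P"
proof (cases "Var x \<in> P")
  case True
  obtain f where f: "P = {a. a * f \<in> edge_ideal E}" and pr: "primeideal P vpoly_ring"
    using P unfolding Ass_edge_ideal by blast
  have "1 \<notin> P" using ideal.one_imp_carrier[of P vpoly_ring] pr primeideal.I_notcarr[OF pr]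
    by (auto simp: primeideal_def)
  then have "f \<notin> edge_ideal E" using f by simp
  then obtain m where m: "m \<in> keys f" "m \<notin> edge_exponents E"
    by (auto simp: edge_ideal_eq monomial_ideal_def)
  have var: "m + Poly_Mapping.single z 1 \<in> edge_exponents E" if "Var z \<in> P" for z
    using that m(1) f keys_times_monomial[of f "Poly_Mapping.single z 1"]
    by (auto simp: edge_ideal_eq monomial_ideal_def Var_def mult.commute[of _ f])
  obtain p q where pq: "{p, q} \<in> E" "0 < lookup (m + Poly_Mapping.single x 1) p"
    "0 < lookup (m + Poly_Mapping.single x 1) q"
    using var[OF True] unfolding mem_edge_exponents[OF E] by blast
  have "p \<noteq> q" using E pq(1) by (auto simp: simple_graph_def)
  have pos: "v = z \<or> 0 < lookup m v" if "0 < lookup (m + Poly_Mapping.single z 1) v" for v z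
    using that by (auto simp: lookup_add lookup_single when_def split: if_splits)
  have "x = p \<or> x = q" using pos[OF pq(2)] pos[OF pq(3)] pq(1) m(2) unfolding mem_edge_exponents[OF E] by blast
  then obtain y where "{x, y} \<in> E" "0 < lookup m y"
    using pq(1) pos[OF pq(2)] pos[OF pq(3)] \<open>p \<noteq> q\<close> by (metis insert_commute)
  then obtain y where y: "{x, y} \<in> E" "0 < lookup m y" by blast
  \<comment> \<open>Since \<open>y\<close> already divides \<open>m\<close>, the factor
    \<open>Var y\<close> does not enlarge the support, so \<open>m\<close> itself would contain an
    edge.\<close>
  have "Var y \<notin> P"
  proof
    assume "Var y \<in> P"
    from var[OF this] show False
      using y(2) m(2) pos unfolding mem_edge_exponents[OF E] by blast
  qed
  with y that show ?thesis by blast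
qed (use that in blast)

text \<open>Each associated prime misses the variable of \<open>x\<close> or of a neighbour of
  \<open>x\<close>. The \<open>k\<close>-th power of this variable lies outside of the prime and
  turns every copy of \<open>c\<close> into a product of \<open>t\<close> edges.\<close>

theorem monomial_in_symbolic_power:
  fixes E :: "'v::finite set set"
  assumes E: "simple_graph E"
    and c: "\<And>y. y = x \<or> {x, y} \<in> E \<Longrightarrow> c + Poly_Mapping.single y 1 \<in> edge_products E t"
    and e: "e \<in> edge_products E q"
  shows "(Poly_Mapping.single ((\<Sum>i<k. c) + e) 1 :: ('v, 'k::field) vpoly)
    \<in> symbolic_power vpoly_ring (edge_ideal E) (k * t + q)"
proof -
  have "(Poly_Mapping.single ((\<Sum>i<k. c) + e) 1 :: ('v, 'k) vpoly)
      \<in> local_contraction vpoly_ring P (ideal_pow vpoly_ring (edge_ideal E) (k * t + q))"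
    if P: "P \<in> Ass vpoly_ring (edge_ideal E :: ('v, 'k) vpoly set)" for P
  proof -
    obtain y where y: "y = x \<or> {x, y} \<in> E" "Var y \<notin> P"
      by (rule Ass_edge_ideal_misses_variable[OF E P])
    have pr: "primeideal P vpoly_ring" using P unfolding Ass_edge_ideal by blast
    have "Poly_Mapping.single (\<Sum>i<k. Poly_Mapping.single y 1) 1 \<notin> P"
    proof (induction k)
      case 0
      then show ?case using ideal.one_imp_carrier[of P vpoly_ring] pr primeideal.I_notcarr[OF pr]
        by (auto simp: primeideal_def)
    next
      case (Suc k)
      show ?case
        using primeideal.I_prime[OF pr, of "Poly_Mapping.single (\<Sum>i<k. Poly_Mapping.single y 1) 1" "Var y"]
          Suc y(2)
        by (auto simp: Var_def mult_single)
    qed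
    moreover have "(\<Sum>i<k. c + Poly_Mapping.single y 1) + e \<in> edge_products E (k * t + q)"
      by (intro iterated_sumset_add iterated_sumset_mult upclosed_edge_exponents c y e)
    ultimately show ?thesis
      unfolding mem_local_contraction[OF pr]
      by (intro exI[of _ "Poly_Mapping.single (\<Sum>i<k. Poly_Mapping.single y 1) 1"])
        (simp add: mult_single sum.distrib add_ac)
  qed
  then show ?thesis by (simp add: symbolic_power_def)
qed

section \<open>Products of ideals and annihilators as conditions on elements\<close>

lemma ideal_prod_subset_iff:
  assumes "ideal N (vpoly_ring :: ('v, 'k::field) vpoly ring)"
  shows "ideal_prod vpoly_ring J M \<subseteq> N \<longleftrightarrow> (\<forall>a\<in>J. \<forall>f\<in>M. a * f \<in> N)"
proof
  assume "ideal_prod vpoly_ring J M \<subseteq> N"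
  then show "\<forall>a\<in>J. \<forall>f\<in>M. a * f \<in> N" using ideal_prod.prod[of _ J _ M vpoly_ring] by auto
next
  assume h: "\<forall>a\<in>J. \<forall>f\<in>M. a * f \<in> N"
  show "ideal_prod vpoly_ring J M \<subseteq> N"
  proof
    fix f assume "f \<in> ideal_prod vpoly_ring J M"
    then show "f \<in> N"
      by induction (use h additive_subgroup.a_closed[OF ideal.axioms(1)[OF assms]] in auto)
  qed
qed

lemma subset_annihilator_iff:
  assumes N: "ideal N (vpoly_ring :: ('v, 'k::field) vpoly ring)"
  shows "J \<subseteq> annihilator vpoly_ring (quot_module vpoly_ring M N) \<longleftrightarrow> (\<forall>a\<in>J. \<forall>f\<in>M. a * f \<in> N)"
proof -
  interpret R: cring "vpoly_ring :: ('v, 'k) vpoly ring" by (rule cring_vpoly_ring)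
  interpret N: ideal N "vpoly_ring :: ('v, 'k) vpoly ring" by (rule N)
  have z: "N +>\<^bsub>vpoly_ring\<^esub> g = N \<longleftrightarrow> g \<in> N" for g :: "('v, 'k) vpoly"
    using N.a_rcos_self[of g] N.a_rcos_const by auto
  have s: "a \<odot>\<^bsub>quot_module vpoly_ring M N\<^esub> (N +>\<^bsub>vpoly_ring\<^esub> f) = N +>\<^bsub>vpoly_ring\<^esub> (a * f)"
    for a f :: "('v, 'k) vpoly"
    using R.quot_module_smult[OF N, of a f M] by simp
  have "\<zero>\<^bsub>quot_module vpoly_ring M N\<^esub> = N"
    "carrier (quot_module vpoly_ring M N) = (\<lambda>f. N +>\<^bsub>vpoly_ring\<^esub> f) ` M"
    by (auto simp: quot_module_def)
  then show ?thesis by (auto simp: annihilator_def s z)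
qed

section \<open>Weighted odd cycles\<close>

text \<open>\<open>S\<close> is a vertex cover of the cycle on the positions below \<open>N\<close>.
  For \<open>N = 1\<close> the cycle is a loop, which forces \<open>0 \<in> S\<close>.\<close>

definition cycle_covered :: "nat \<Rightarrow> (nat \<Rightarrow> nat) \<Rightarrow> nat \<Rightarrow> bool" where
  "cycle_covered N a s \<longleftrightarrow>
     (\<forall>S\<subseteq>{..<N}. (\<forall>i<N. i \<in> S \<or> Suc i mod N \<in> S) \<longrightarrow> s \<le> sum a S)"

text \<open>Position \<open>i\<close> also names the edge between \<open>i\<close> and \<open>i + 1\<close>; the packing takes \<open>j\<close> copies of the
  whole cycle of length \<open>2n + 1\<close>, each worth \<open>n + 1\<close>, and \<open>y i\<close> copies of edge \<open>i\<close>, each worth 1.\<close>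

definition cycle_packing :: "nat \<Rightarrow> (nat \<Rightarrow> nat) \<Rightarrow> nat \<Rightarrow> (nat \<Rightarrow> nat) \<Rightarrow> bool" where
  "cycle_packing N a j y \<longleftrightarrow>
     (\<forall>i<N. j + y i + y (Suc i mod N) \<le> a (Suc i mod N))"

text \<open>Rotation by \<open>d\<close> and its inverse; taking \<open>N - d mod N\<close> keeps
  the subtraction exact.\<close>

lemma shift_mod:
  fixes N d :: nat
  assumes "0 < N"
  defines "f \<equiv> \<lambda>i. (i + d) mod N" and "g \<equiv> \<lambda>i. (i + (N - d mod N)) mod N"
  shows "i < N \<Longrightarrow> f (g i) = i" "i < N \<Longrightarrow> g (f i) = i"
    "Suc (f i) mod N = f (Suc i mod N)" "Suc (g i) mod N = g (Suc i mod N)"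
    "f i < N" "g i < N"
proof -
  have d: "d mod N + (N - d mod N) = N" using assms(1) by simp
  have "f (g i) = (i + (N - d mod N) + d mod N) mod N" unfolding f_def g_def by (simp add: mod_simps)
  also have "\<dots> = (i + N) mod N" using d by (simp add: algebra_simps)
  finally show "i < N \<Longrightarrow> f (g i) = i" by simp
  have "g (f i) = ((i + d mod N) mod N + (N - d mod N)) mod N"
    unfolding f_def g_def by (simp only: mod_add_right_eq)
  also have "\<dots> = (i + d mod N + (N - d mod N)) mod N" by (simp only: mod_add_left_eq)
  also have "\<dots> = (i + N) mod N" using d by (simp add: algebra_simps)
  finally show "i < N \<Longrightarrow> g (f i) = i" by simp
  show "Suc (f i) mod N = f (Suc i mod N)" "Suc (g i) mod N = g (Suc i mod N)"
    unfolding f_def g_def by (simp_all add: mod_simps)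
  show "f i < N" "g i < N" unfolding f_def g_def using assms(1) by simp_all
qed

lemma cycle_covered_shift:
  assumes "0 < N" "cycle_covered N a s"
  shows "cycle_covered N (\<lambda>i. a ((i + d) mod N)) s"
  unfolding cycle_covered_def
proof (intro allI impI)
  fix S assume S: "S \<subseteq> {..<N}" "\<forall>i<N. i \<in> S \<or> Suc i mod N \<in> S"
  define f where "f i = (i + d) mod N" for i
  define g where "g i = (i + (N - d mod N)) mod N" for i
  note sh = shift_mod[OF assms(1), of _ d, folded f_def g_def]
  have "inj_on f S" by (rule inj_on_inverseI[of _ g]) (use sh(2) S(1) in auto)
  then have "sum a (f ` S) = (\<Sum>i\<in>S. a (f i))" by (simp add: sum.reindex)
  moreover have "i \<in> f ` S \<or> Suc i mod N \<in> f ` S" if "i < N" for i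
    using S(2) sh(1)[OF that] sh(3)[of "g i"] sh(6)[of i] by (metis imageI)
  moreover have "f ` S \<subseteq> {..<N}" using sh(5) by auto
  ultimately show "s \<le> (\<Sum>i\<in>S. a ((i + d) mod N))"
    using assms(2) unfolding cycle_covered_def f_def by metis
qed

lemma cycle_packing_unshift:
  assumes "0 < N" "cycle_packing N (\<lambda>i. a ((i + d) mod N)) j y"
  obtains z where "cycle_packing N a j z" "sum z {..<N} = sum y {..<N}"
proof
  define f where "f i = (i + d) mod N" for i
  define g where "g i = (i + (N - d mod N)) mod N" for i
  note sh = shift_mod[OF assms(1), of _ d, folded f_def g_def]
  have y: "j + y i + y (Suc i mod N) \<le> a (f (Suc i mod N))" if "i < N" for i
    using assms(2) that by (simp add: cycle_packing_def f_def)
  have "j + y (g i) + y (g (Suc i mod N)) \<le> a (Suc i mod N)" if "i < N" for i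
    using y[OF sh(6)[of i]] sh(4)[of i] sh(1)[of "Suc i mod N"] assms(1) by simp
  then show "cycle_packing N a j (\<lambda>i. y (g i))" by (simp add: cycle_packing_def)
  show "(\<Sum>i<N. y (g i)) = sum y {..<N}"
    by (rule sum.reindex_bij_witness[of _ f g]) (use sh in auto)
qed

text \<open>The vertices \<open>p, p + 1, p + 2\<close> are folded into one vertex of weight \<open>a p + a (p + 2) - b\<close>: a cover
  containing the new vertex corresponds to one containing \<open>p\<close> and \<open>p + 2\<close>, the other covers to covers
  containing \<open>p + 1\<close>. Either way \<open>b\<close> is the difference of the weights.\<close>

lemma cycle_covered_fold:
  assumes cov: "cycle_covered (p + 3) a s"
    and b: "b = min (a (p + 1)) (a p + a (p + 2))"
  shows "cycle_covered (p + 1) (a(p := a p + a (p + 2) - b)) (s - b)" (is "cycle_covered _ ?a _")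
  unfolding cycle_covered_def
proof (intro allI impI)
  fix S assume S: "S \<subseteq> {..<p + 1}" "\<forall>i<p + 1. i \<in> S \<or> Suc i mod (p + 1) \<in> S"
  have fin: "finite S" using S(1) finite_subset by blast
  have low: "i \<in> S \<or> Suc i \<in> S" if "i < p" for i using S(2)[rule_format, of i] that by simp
  \<comment> \<open>A set containing \<open>S\<close> already covers the edges below
    \<open>p\<close>; the edges at positions \<open>p\<close>, \<open>p + 1\<close> and
    \<open>p + 2\<close> remain.\<close>
  have use_cov: "s \<le> sum a T"
    if "T \<subseteq> {..<p + 3}" "S \<subseteq> T" "p \<in> T \<or> p + 1 \<in> T" "p + 1 \<in> T \<or> p + 2 \<in> T" "p + 2 \<in> T \<or> 0 \<in> T" for T
  proof -
    have "i \<in> T \<or> Suc i mod (p + 3) \<in> T" if i: "i < p + 3" for i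
    proof -
      consider "i < p" | "i = p" | "i = p + 1" | "i = p + 2" using i by linarith
      then show ?thesis
      proof cases
        case 1
        then show ?thesis using low[OF 1] \<open>S \<subseteq> T\<close> by auto
      next
        case 4
        then have "Suc i mod (p + 3) = 0" by (simp add: numeral_3_eq_3)
        then show ?thesis using 4 \<open>p + 2 \<in> T \<or> 0 \<in> T\<close> by auto
      qed (use \<open>p \<in> T \<or> p + 1 \<in> T\<close> \<open>p + 1 \<in> T \<or> p + 2 \<in> T\<close> in auto)
    qed
    then show ?thesis using cov that(1) by (simp add: cycle_covered_def)
  qed
  have p2: "p + 2 \<notin> S" "p + 1 \<notin> S" using S(1) by auto
  show "s - b \<le> sum ?a S"
  proof (cases "p \<in> S")
    case True
    have "s \<le> sum a (insert (p + 2) S)" by (rule use_cov) (use S(1) True in auto)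
    also have "\<dots> = a (p + 2) + (a p + sum a (S - {p}))"
      using fin p2 sum.remove[OF fin True, of a] by simp
    finally have "s \<le> a (p + 2) + (a p + sum a (S - {p}))" .
    moreover have "sum ?a S = a p + a (p + 2) - b + sum a (S - {p})"
      using sum.remove[OF fin True, of ?a] by simp
    ultimately show ?thesis using b by linarith
  next
    case False
    \<comment> \<open>In the short cycle the edge \<open>p\<close> leads back to 0, so
      \<open>S\<close> already covers the edge from \<open>p + 2\<close> to 0 of the long one. Hence
      both \<open>p + 1\<close> and the pair \<open>p\<close>, \<open>p + 2\<close> complete
      \<open>S\<close> to a cover, and the cheaper choice costs \<open>b\<close>.\<close>
    have 0: "0 \<in> S" using S(2)[rule_format, of p] False by simp
    have a: "sum ?a S = sum a S" by (rule sum.cong) (use False in auto)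
    have "s \<le> sum a (insert (p + 1) S)" by (rule use_cov) (use S(1) 0 in auto)
    then have 1: "s \<le> a (p + 1) + sum a S" using fin p2 by simp
    have "s \<le> sum a (insert p (insert (p + 2) S))" by (rule use_cov) (use S(1) 0 in auto)
    then have "s \<le> a p + (a (p + 2) + sum a S)" using fin p2 False by simp
    with 1 show ?thesis unfolding a by (simp add: b)
  qed
qed

text \<open>The two edges at the folded vertex become the edge into \<open>p\<close> and the edge
  out of \<open>p + 2\<close>; the new edges at \<open>p + 1\<close> receive \<open>x\<close> and
  \<open>w\<close> with \<open>j + x + w = b\<close>. Maximality of \<open>a (p + 1)\<close> gives
  \<open>a p \<le> b\<close> and \<open>a (p + 2) \<le> b\<close>, which makes this split fit. The
  \<open>j\<close> in the sum is made up for by each whole cycle gaining 1 in value.\<close>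

lemma cycle_packing_unfold:
  assumes pk: "cycle_packing (p + 1) (a(p := a p + a (p + 2) - b)) j y"
    and b: "b = min (a (p + 1)) (a p + a (p + 2))"
    and max: "a p \<le> a (p + 1)" "a (p + 2) \<le> a (p + 1)"
  obtains z where "cycle_packing (p + 3) a j z" "sum z {..<p + 3} + j = sum y {..<p + 1} + b"
proof
  \<comment> \<open>The load of the edge entering \<open>p\<close>. For \<open>p = 0\<close> the
    truncated \<open>p - 1\<close> is 0, which is right since the short cycle is then a
    loop.\<close>
  define h where "h = y (p - 1)"
  have pk: "j + y i + y (Suc i mod (p + 1)) \<le> (a(p := a p + a (p + 2) - b)) (Suc i mod (p + 1))"
    if "i < p + 1" for i
    using pk that unfolding cycle_packing_def by blast
  have t: "j + h + y p \<le> a p + a (p + 2) - b"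
    using pk[of "p - 1"] by (cases p) (auto simp: h_def)
  \<comment> \<open>Vertex \<open>p\<close> takes as much of \<open>b - j\<close> as its capacity
    allows; the rest goes to the edge ending in \<open>p + 2\<close>.\<close>
  define x where "x = min (b - j) (a p - j - h)"
  define w where "w = b - j - x"
  have f: "a p \<le> b" "a (p + 2) \<le> b" "b \<le> a p + a (p + 2)" "b \<le> a (p + 1)" using max b by auto
  have jb: "j \<le> b" using t f by linarith
  have u: "j + h + x \<le> a p" using t f unfolding x_def by linarith
  have w: "j + w + y p \<le> a (p + 2)" using t f jb unfolding w_def x_def by linarith
  have v: "j + x + w = b" using jb unfolding w_def x_def by linarith
  let ?z = "y(p := x, p + 1 := w, p + 2 := y p)"
  have "j + ?z i + ?z (Suc i mod (p + 3)) \<le> a (Suc i mod (p + 3))" if i: "i < p + 3" for i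
  proof -
    consider "Suc i < p" | "Suc i = p" | "i = p" | "i = p + 1" | "i = p + 2" using i by linarith
    then show ?thesis
    proof cases
      case 1
      then show ?thesis using pk[of i] by simp
    next
      case 2
      then show ?thesis using u by (auto simp: h_def)
    next
      case 3
      then show ?thesis using v f by simp
    next
      case 4
      then show ?thesis using w by simp
    next
      case 5
      then have "Suc i mod (p + 3) = 0" by (simp add: numeral_3_eq_3)
      then show ?thesis using 5 u pk[of p] by (cases "p = 0") (auto simp: h_def)
    qed
  qed
  then show "cycle_packing (p + 3) a j ?z" by (simp add: cycle_packing_def)
  have "sum ?z {..<p + 3} = sum ?z {..<p} + x + w + y p" by (simp add: numeral_3_eq_3)
  also have "sum ?z {..<p} = sum y {..<p}" by (rule sum.cong) auto
  finally have "sum ?z {..<p + 3} = sum y {..<p} + x + w + y p" .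
  moreover have "sum y {..<p + 1} = sum y {..<p} + y p" by simp
  ultimately show "sum ?z {..<p + 3} + j = sum y {..<p + 1} + b" using v by linarith
qed

text \<open>Induction by folding three vertices into one, after rotating the heaviest vertex into
  the middle of the three. A fold removes \<open>b\<close> from the cover bound, and the unfolding
  returns it to the packing.\<close>

theorem odd_cycle_packing:
  assumes "cycle_covered (2 * n + 1) a s"
  shows "\<exists>j y. cycle_packing (2 * n + 1) a j y \<and> s \<le> j * (n + 1) + sum y {..<2 * n + 1}"
  using assms
proof (induction n arbitrary: a s)
  case 0
  have "s \<le> sum a {0}" using 0 unfolding cycle_covered_def by (elim allE[of _ "{0}"]) auto
  \<comment> \<open>A single vertex with a loop: a whole cycle is worth 1 here, so
    \<open>a 0\<close> of them suffice.\<close>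
  then show ?case by (intro exI[of _ "a 0"] exI[of _ "\<lambda>_. 0"]) (simp add: cycle_packing_def)
next
  case (Suc n)
  let ?p = "2 * n" let ?N = "2 * n + 3"
  have N: "2 * Suc n + 1 = ?N" by simp
  define M where "M = Max (a ` {..<?N})"
  have "M \<in> a ` {..<?N}" unfolding M_def by (rule Max_in) (auto simp: lessThan_empty_iff)
  then obtain m where m: "m < ?N" "a m = M" by auto
  \<comment> \<open>With the shift \<open>m + 2\<close> the maximum sits at
    \<open>2 * n + 1\<close>, as \<open>2 * n + 1 + (m + 2) = m + (2 * n + 3)\<close>.\<close>
  define c where "c i = a ((i + (m + 2)) mod ?N)" for i
  have "?p + 1 + (m + 2) = m + ?N" by simp
  then have "c (?p + 1) = M" using m unfolding c_def by (metis mod_add_self2 mod_less)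
  moreover have "c i \<le> M" for i unfolding M_def c_def by (rule Max_ge) auto
  ultimately have max: "c ?p \<le> c (?p + 1)" "c (?p + 2) \<le> c (?p + 1)" by simp_all
  define b where "b = min (c (?p + 1)) (c ?p + c (?p + 2))"
  have "cycle_covered ?N c s"
    unfolding c_def by (rule cycle_covered_shift[OF _ Suc.prems[unfolded N]]) simp
  from Suc.IH[OF cycle_covered_fold[OF this b_def]] obtain j y where
    y: "cycle_packing (?p + 1) (c(?p := c ?p + c (?p + 2) - b)) j y"
      "s - b \<le> j * (n + 1) + sum y {..<?p + 1}" by blast
  obtain z where z: "cycle_packing ?N c j z" "sum z {..<?N} + j = sum y {..<?p + 1} + b"
    using cycle_packing_unfold[OF y(1) b_def max] by blast
  obtain z' where z': "cycle_packing ?N a j z'" "sum z' {..<?N} = sum z {..<?N}"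
    using cycle_packing_unshift[of ?N a "m + 2" j z] z(1) unfolding c_def by auto
  have "s \<le> j * (Suc n + 1) + sum z' {..<?N}" using y(2) z(2) z'(2) by simp
  then show ?case using z'(1) unfolding N by blast
qed

section \<open>Unicyclic graphs\<close>

lemma cycle_edges_Suc: "Suc i < length xs \<Longrightarrow> {xs ! i, xs ! Suc i} \<in> cycle_edges xs"
  unfolding cycle_edges_def by (auto intro!: exI[of _ i])

lemma unicyclicD:
  assumes "unicyclic E xs"
  shows "simple_graph E" "is_cycle E xs" "is_cycle E ys \<Longrightarrow> cycle_edges ys = cycle_edges xs"
  using assms unfolding unicyclic_def by blast+

lemma simple_graph_no_loop: "simple_graph E \<Longrightarrow> {u, v} \<in> E \<Longrightarrow> u \<noteq> v"
  by (auto simp: simple_graph_def)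

text \<open>The path \<open>ys\<close> outside of the cycle and the arc from \<open>i\<close> to
  \<open>j\<close> form a cycle with the closing edge, and uniqueness identifies it with
  \<open>xs\<close>. The term \<open>hd (ys @ [xs ! i])\<close> is the start of the path, or of the
  arc if \<open>ys\<close> is empty.\<close>

lemma unicyclic_closing_edge:
  assumes uni: "unicyclic E xs" and ij: "i \<le> j" "j < length xs"
    and ys: "distinct ys" "set ys \<inter> set xs = {}" "3 \<le> length ys + (Suc j - i)"
    and path: "\<And>k. Suc k < length ys \<Longrightarrow> {ys ! k, ys ! Suc k} \<in> E"
    and join: "ys \<noteq> [] \<Longrightarrow> {last ys, xs ! i} \<in> E"
    and closing: "{xs ! j, hd (ys @ [xs ! i])} \<in> E"
  shows "{xs ! j, hd (ys @ [xs ! i])} \<in> cycle_edges xs"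
proof -
  define zs where "zs = take (Suc j - i) (drop i xs)"
  define ws where "ws = ys @ zs"
  have xs: "distinct xs" "cycle_edges xs \<subseteq> E" using unicyclicD(2)[OF uni] by (auto simp: is_cycle_def)
  have lz: "length zs = Suc j - i" using ij unfolding zs_def by simp
  have nz: "zs ! k = xs ! (i + k)" if "k < Suc j - i" for k using ij that unfolding zs_def by simp
  have L: "length ws = length ys + (Suc j - i)" by (simp add: ws_def lz)
  have "set zs \<subseteq> set xs" unfolding zs_def by (meson set_drop_subset set_take_subset subset_trans)
  then have dist: "distinct ws" unfolding ws_def using ys xs(1) by (auto simp: zs_def)
  have nthw: "ws ! k = (if k < length ys then ys ! k else xs ! (i + (k - length ys)))"
    if "k < length ws" for k
    using that by (auto simp: ws_def nth_append nz lz)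
  have w0: "ws ! 0 = hd (ys @ [xs ! i])" using nthw[of 0] L ij by (cases ys) auto
  have "length ws - 1 < length ws" "\<not> length ws - 1 < length ys" "i + (length ws - 1 - length ys) = j"
    using L ij by auto
  then have wl: "ws ! (length ws - 1) = xs ! j" by (simp only: nthw if_False)
  have closing_pos: "{ws ! (length ws - 1), ws ! (Suc (length ws - 1) mod length ws)} = {xs ! j, hd (ys @ [xs ! i])}"
  proof -
    have "0 < length ws" using L ij by simp
    then have "Suc (length ws - 1) = length ws" by (rule Suc_diff_1)
    then have "Suc (length ws - 1) mod length ws = 0" by (simp only: mod_self)
    then show ?thesis by (simp only: wl w0)
  qed
  have "{ws ! k, ws ! (Suc k mod length ws)} \<in> E" if k: "k < length ws" for k
  proof -
    consider "k = length ws - 1" | "Suc k < length ys" | "Suc k = length ys" | "length ys \<le> k" "Suc k < length ws"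
      using k by linarith
    then show ?thesis
    proof cases
      case 1
      show ?thesis unfolding 1 closing_pos by (rule closing)
    next
      case 2
      then show ?thesis using path[OF 2] nthw[of k] nthw[of "Suc k"] L by simp
    next
      case 3
      then have "ys \<noteq> []" "k = length ys - 1" by auto
      then have "ws ! k = last ys" using nthw[OF k] 3 by (simp add: last_conv_nth)
      moreover have "ws ! (Suc k mod length ws) = xs ! i" using nthw[of "Suc k"] 3 L ij by simp
      ultimately show ?thesis using join[OF \<open>ys \<noteq> []\<close>] by simp
    next
      case 4
      define p where "p = i + (k - length ys)"
      have "Suc p < length xs" using 4 L ij unfolding p_def by linarith
      then have "{xs ! p, xs ! Suc p} \<in> E" using cycle_edges_Suc xs(2) by blast
      moreover have "ws ! k = xs ! p" using nthw[OF k] 4(1) unfolding p_def by simp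
      moreover have "Suc k - length ys = Suc (k - length ys)" using 4(1) by simp
      then have "ws ! Suc k = xs ! Suc p" using nthw[OF 4(2)] 4(1) unfolding p_def by simp
      moreover have "Suc k mod length ws = Suc k" using 4(2) by simp
      ultimately show ?thesis by simp
    qed
  qed
  then have "cycle_edges ws \<subseteq> E" unfolding cycle_edges_def by blast
  then have "is_cycle E ws" unfolding is_cycle_def using dist ys(3) L by simp
  then have "cycle_edges ws = cycle_edges xs" by (rule unicyclicD(3)[OF uni])
  moreover have "{xs ! j, hd (ys @ [xs ! i])} \<in> cycle_edges ws"
    unfolding cycle_edges_def closing_pos[symmetric] using \<open>length ws - 1 < length ws\<close> by blast
  ultimately show ?thesis by simp
qed

lemma cycle_edge_subset: "e \<in> cycle_edges xs \<Longrightarrow> e \<subseteq> set xs"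
  unfolding cycle_edges_def by (auto intro!: nth_mem mod_less_divisor)

text \<open>The case of an empty path: an edge between nonconsecutive positions closes the arc
  between them to a cycle.\<close>

lemma unicyclic_no_chord:
  assumes uni: "unicyclic E xs" and e: "{u, v} \<in> E" "u \<in> set xs" "v \<in> set xs"
  shows "{u, v} \<in> cycle_edges xs"
proof -
  have ordered: "{xs ! i, xs ! j} \<in> cycle_edges xs" if "i < j" "j < length xs" "{xs ! i, xs ! j} \<in> E" for i j
  proof (cases "j = Suc i")
    case True
    then show ?thesis using that cycle_edges_Suc by simp
  next
    case False
    have "{xs ! j, xs ! i} \<in> cycle_edges xs"
      using unicyclic_closing_edge[OF uni, of i j "[]"] that False by (simp add: insert_commute)
    then show ?thesis by (simp add: insert_commute)
  qed
  obtain i j where ij: "i < length xs" "j < length xs" "u = xs ! i" "v = xs ! j"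
    using e by (metis in_set_conv_nth)
  have "u \<noteq> v" by (rule simple_graph_no_loop[OF unicyclicD(1)[OF uni] e(1)])
  then consider "i < j" | "j < i" using ij(3,4) by (cases i j rule: linorder_cases) auto
  then show ?thesis
  proof cases
    case 1
    then show ?thesis using ordered[of i j] ij e(1) by simp
  next
    case 2
    then have "{v, u} \<in> cycle_edges xs" using ordered[of j i] ij e(1) by (simp add: insert_commute)
    then show ?thesis by (simp add: insert_commute)
  qed
qed

text \<open>The path is the single vertex \<open>l\<close>. With two neighbours on the cycle it
  would close to a cycle leaving \<open>set xs\<close>, which the unique cycle does not.\<close>

lemma unicyclic_unique_cycle_neighbour:
  assumes uni: "unicyclic E xs" and l: "l \<notin> set xs"
    and e: "{l, u} \<in> E" "{l, v} \<in> E" "u \<in> set xs" "v \<in> set xs"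
  shows "u = v"
proof -
  have no_two: False if "i < j" "j < length xs" "{l, xs ! i} \<in> E" "{l, xs ! j} \<in> E" for i j
  proof -
    have c: "{xs ! j, l} \<in> E" using that(4) by (simp add: insert_commute)
    have "{xs ! j, hd ([l] @ [xs ! i])} \<in> cycle_edges xs"
      by (rule unicyclic_closing_edge[OF uni]) (use that(1-3) c l in simp_all)
    from cycle_edge_subset[OF this] show False using l by simp
  qed
  obtain i j where "i < length xs" "j < length xs" "u = xs ! i" "v = xs ! j"
    using e by (metis in_set_conv_nth)
  then show ?thesis using e(1,2) no_two[of i j] no_two[of j i] by (cases i j rule: linorder_cases) auto
qed

text \<open>Both outside vertices have neighbours on the cycle, so an edge between them would be a
  path that closes to a second cycle.\<close>

lemma unicyclic_outside_independent:
  assumes uni: "unicyclic E xs" and all: "\<forall>v. v \<in> closed_nbhd E (set xs)"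
    and out: "u \<notin> set xs" "v \<notin> set xs"
  shows "{u, v} \<notin> E"
proof
  assume e: "{u, v} \<in> E"
  \<comment> \<open>The case \<open>i = j\<close> is included; the new cycle is then a
    triangle.\<close>
  have F: False if "i \<le> j" "j < length xs" "{x, y} \<in> E" "{x, xs ! j} \<in> E" "{y, xs ! i} \<in> E"
    "x \<notin> set xs" "y \<notin> set xs" for i j x y
  proof -
    have "x \<noteq> y" by (rule simple_graph_no_loop[OF unicyclicD(1)[OF uni] that(3)])
    have c: "{xs ! j, x} \<in> E" using that(4) by (simp add: insert_commute)
    have "{xs ! j, hd ([x, y] @ [xs ! i])} \<in> cycle_edges xs"
    proof (rule unicyclic_closing_edge[OF uni that(1,2)])
      show "{[x, y] ! k, [x, y] ! Suc k} \<in> E" if "Suc k < length [x, y]" for k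
        using \<open>{x, y} \<in> E\<close> that by simp
      show "3 \<le> length [x, y] + (Suc j - i)" using that(1) by simp
    qed (use that(5-7) c \<open>x \<noteq> y\<close> in simp_all)
    from cycle_edge_subset[OF this] show False using that(6) by simp
  qed
  have "\<exists>i<length xs. {x, xs ! i} \<in> E" if x: "x \<notin> set xs" for x
  proof -
    have "x \<in> closed_nbhd E (set xs)" using all by (rule spec)
    then obtain w where w: "w \<in> set xs" "{x, w} \<in> E" using x by (auto simp: closed_nbhd_def)
    then obtain i where "i < length xs" "w = xs ! i" by (auto simp: in_set_conv_nth)
    with w(2) show ?thesis by blast
  qed
  from this[OF out(1)] this[OF out(2)] obtain i j where
    ij: "i < length xs" "j < length xs" "{u, xs ! j} \<in> E" "{v, xs ! i} \<in> E" by blast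
  have e': "{v, u} \<in> E" using e by (simp add: insert_commute)
  show False
    using nat_le_linear[of i j] F[OF _ ij(2) e ij(3,4) out] F[OF _ ij(1) e' ij(4,3) out(2,1)] by blast
qed

section \<open>The product of the cycle variables and the lower bound\<close>

definition cycle_product :: "'v list \<Rightarrow> 'v \<Rightarrow>\<^sub>0 nat" where
  "cycle_product xs = (\<Sum>v\<in>set xs. Poly_Mapping.single v 1)"

lemma lookup_cycle_product: "lookup (cycle_product xs) v = (if v \<in> set xs then 1 else 0)"
  by (simp add: cycle_product_def lookup_sum lookup_single when_def)

lemma edge_products_sum:
  assumes "finite A" "\<And>i. i \<in> A \<Longrightarrow> f i \<in> edge_products E (g i)"
  shows "sum f A \<in> edge_products E (sum g A)"
  using assms
  by (induction rule: finite_induct) (simp_all add: iterated_sumset_add[OF upclosed_edge_exponents])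

locale odd_unicyclic =
  fixes E :: "'v::finite set set" and xs :: "'v list" and n :: nat
  assumes uni: "unicyclic E xs" and len: "length xs = 2 * n + 1"
begin

lemma simple: "simple_graph E" and dist: "distinct xs"
  and cyc_sub: "cycle_edges xs \<subseteq> E" and n_pos: "0 < n"
  using unicyclicD(1,2)[OF uni] len by (auto simp: is_cycle_def)

lemma cycle_edge: "i < 2 * n + 1 \<Longrightarrow> {xs ! i, xs ! (Suc i mod (2 * n + 1))} \<in> E"
  using cyc_sub unfolding cycle_edges_def len by blast

text \<open>Without the vertex \<open>xs ! p\<close> the odd cycle is a path with a perfect matching.\<close>

lemma cycle_product_matching:
  assumes p: "p < 2 * n + 1"
  shows "\<exists>t\<in>edge_products E n. cycle_product xs = t + Poly_Mapping.single (xs ! p) 1"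
proof -
  let ?N = "2 * n + 1"
  \<comment> \<open>\<open>h\<close> runs through the cycle starting right after \<open>p\<close>,
    so that \<open>p\<close> comes last, at index \<open>2 * n\<close>, and the others pair up
    consecutively.\<close>
  define h where "h k = Poly_Mapping.single (xs ! ((k + Suc p) mod ?N)) (1 :: nat)" for k
  note sh = shift_mod[of ?N _ "Suc p"]
  have "(\<Sum>k<?N. h k) = (\<Sum>k<?N. Poly_Mapping.single (xs ! k) 1)"
    by (rule sum.reindex_bij_witness[of _ "\<lambda>i. (i + (?N - Suc p mod ?N)) mod ?N" "\<lambda>i. (i + Suc p) mod ?N"])
      (use sh in \<open>auto simp: h_def\<close>)
  also have "\<dots> = cycle_product xs"
    unfolding cycle_product_def
    by (rule sum.reindex_bij_betw) (use bij_betw_nth[OF dist, of "{..<?N}"] len in auto)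
  finally have c: "cycle_product xs = (\<Sum>k<2 * n. h k) + h (2 * n)" by simp
  have "(\<Sum>k<2 * q. h k) = (\<Sum>i<q. h (2 * i) + h (2 * i + 1))" for q
    by (induction q) (simp_all add: add.assoc)
  moreover have "h (2 * i) + h (2 * i + 1) \<in> edge_products E 1" for i
    unfolding h_def using cycle_edge[of "(2 * i + Suc p) mod ?N"]
    by (intro edge_mem_edge_products) (simp add: mod_Suc_eq)
  ultimately have "(\<Sum>k<2 * n. h k) \<in> edge_products E n"
    using edge_products_sum[of "{..<n}" "\<lambda>i. h (2 * i) + h (2 * i + 1)" E "\<lambda>_. 1"] by simp
  moreover have "2 * n + Suc p = p + ?N" by simp
  then have "h (2 * n) = Poly_Mapping.single (xs ! p) 1"
    unfolding h_def using p by (metis mod_add_self2 mod_less)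
  ultimately show ?thesis using c by auto
qed

lemma cycle_product_mem: "cycle_product xs \<in> edge_products E n"
  using cycle_product_matching[of 0] upclosedD[OF upclosed_iterated_sumset[OF upclosed_edge_exponents]]
  by auto

text \<open>Match all cycle vertices except \<open>w\<close>; the free \<open>w\<close> then pairs
  with \<open>y\<close>.\<close>

lemma cycle_product_times_neighbour:
  assumes w: "w \<in> set xs" "{y, w} \<in> E"
  shows "cycle_product xs + Poly_Mapping.single y 1 \<in> edge_products E (n + 1)"
proof -
  obtain p where p: "p < 2 * n + 1" "w = xs ! p" using w(1) len by (metis in_set_conv_nth)
  obtain t where t: "t \<in> edge_products E n" "cycle_product xs = t + Poly_Mapping.single w 1"
    using cycle_product_matching[OF p(1)] p(2) by blast
  have "t + (Poly_Mapping.single y 1 + Poly_Mapping.single w 1) \<in> edge_products E (n + 1)"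
    by (rule iterated_sumset_add[OF upclosed_edge_exponents t(1) edge_mem_edge_products[OF w(2)]])
  then show ?thesis unfolding t(2) by (simp add: add_ac)
qed

lemma cycle_vertex_neighbour:
  assumes "y \<in> set xs"
  shows "\<exists>w\<in>set xs. {y, w} \<in> E"
proof -
  obtain i where i: "i < 2 * n + 1" "y = xs ! i" using assms len by (metis in_set_conv_nth)
  have "xs ! (Suc i mod (2 * n + 1)) \<in> set xs" by (rule nth_mem) (simp add: len)
  then show ?thesis using cycle_edge[OF i(1)] i(2) by blast
qed

lemma cycle_product_closed_nbhd:
  assumes "y \<in> closed_nbhd E (set xs)"
  shows "cycle_product xs + Poly_Mapping.single y 1 \<in> edge_products E (n + 1)"
  using assms cycle_product_times_neighbour cycle_vertex_neighbour unfolding closed_nbhd_def by blast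

text \<open>Each edge factor uses two variables of \<open>D\<close>. With \<open>D = UNIV\<close>
  this is a degree bound; with the cycle as \<open>D\<close> it discounts variables that no edge of
  the support can use.\<close>

lemma edge_products_weight:
  assumes "m \<in> edge_products E s"
    and "\<And>u v. \<lbrakk>{u, v} \<in> E; 0 < lookup m u; 0 < lookup m v\<rbrakk> \<Longrightarrow> u \<in> D \<and> v \<in> D"
  shows "2 * s \<le> weight D m"
  using assms
proof (induction s arbitrary: m)
  case (Suc s)
  then obtain a u v b where m: "m = a + (Poly_Mapping.single u 1 + Poly_Mapping.single v 1 + b)"
    "a \<in> edge_products E s" "{u, v} \<in> E"
    by (auto simp: sumset_def edge_exponents_def)
  have "u \<in> D \<and> v \<in> D" using m by (intro Suc.prems(2)) (auto simp: lookup_add)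
  moreover have "2 * s \<le> weight D a"
    using m by (intro Suc.IH Suc.prems(2)) (auto simp: lookup_add)
  ultimately show ?case using m(1) by (simp add: weight_add weight_single)
qed simp

lemma edge_power_mem:
  "(\<Sum>i<r. Poly_Mapping.single (xs ! 0) 1 + Poly_Mapping.single (xs ! 1) 1) \<in> edge_products E r"
proof -
  have "{xs ! 0, xs ! 1} \<in> E" using cycle_edge[of 0] n_pos by simp
  from iterated_sumset_mult[OF upclosed_edge_exponents edge_mem_edge_products[OF this], of r] show ?thesis
    by simp
qed

text \<open>For \<open>s = k * (n + 1) + r\<close> its degree is \<open>2 * s - k\<close>, which is
  \<open>k\<close> short of what \<open>s\<close> edges require.\<close>

definition witness :: "nat \<Rightarrow> nat \<Rightarrow> 'v \<Rightarrow>\<^sub>0 nat" where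
  "witness k r = (\<Sum>i<k. cycle_product xs) +
     (\<Sum>i<r. Poly_Mapping.single (xs ! 0) 1 + Poly_Mapping.single (xs ! 1) 1)"

text \<open>The first cycle vertex and its neighbours lie in the closed neighbourhood of the cycle,
  so whichever of their variables an associated prime misses completes the cycle products to
  products of edges.\<close>

lemma witness_symbolic:
  "(Poly_Mapping.single (witness k r) 1 :: ('v, 'k::field) vpoly)
    \<in> symbolic_power vpoly_ring (edge_ideal E) (k * (n + 1) + r)"
  unfolding witness_def
proof (rule monomial_in_symbolic_power[OF simple _ edge_power_mem])
  fix y assume "y = xs ! 0 \<or> {xs ! 0, y} \<in> E"
  moreover have "xs ! 0 \<in> set xs" using len by (intro nth_mem) simp
  ultimately have "y \<in> closed_nbhd E (set xs)" unfolding closed_nbhd_def by (auto simp: insert_commute)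
  then show "cycle_product xs + Poly_Mapping.single y 1 \<in> edge_products E (n + 1)"
    by (rule cycle_product_closed_nbhd)
qed

lemma weight_witness:
  assumes "set xs \<subseteq> D"
  shows "weight D (witness k r) = k * (2 * n + 1) + 2 * r"
proof -
  have "xs ! 0 \<in> D" "xs ! 1 \<in> D" using len n_pos assms by (auto intro!: subsetD[OF assms] nth_mem)
  moreover have "weight D (cycle_product xs) = card (set xs)"
    unfolding weight_def lookup_cycle_product using assms by (simp add: sum.If_cases Int_absorb1)
  ultimately show ?thesis
    using dist len by (simp add: witness_def weight_add weight_sum weight_single distinct_card)
qed

lemma lookup_witness_outside: "v \<notin> set xs \<Longrightarrow> lookup (witness k r) v = 0"
  using len n_pos nth_mem[of 0 xs] nth_mem[of 1 xs]
  by (auto simp: witness_def lookup_add lookup_sum lookup_cycle_product lookup_single when_def)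

text \<open>The vertex \<open>v\<close> has no neighbour in the support, so only cycle variables can
  form edges, and their degree is \<open>2 * s - 1\<close>.\<close>

lemma times_witness_not_in_power_outside:
  assumes v: "v \<notin> closed_nbhd E (set xs)" and s: "n + 1 \<le> s"
  shows "Poly_Mapping.single v \<gamma> + witness 1 (s - (n + 1)) \<notin> edge_products E s" (is "?m \<notin> _")
proof
  have vC: "v \<notin> set xs" using v by (auto simp: closed_nbhd_def)
  assume "?m \<in> edge_products E s"
  moreover have "u \<in> set xs \<and> w \<in> set xs"
    if e: "{u, w} \<in> E" "0 < lookup ?m u" "0 < lookup ?m w" for u w
  proof -
    have pos: "x = v \<or> x \<in> set xs" if "0 < lookup ?m x" for x
      using that lookup_witness_outside[of x 1 "s - (n + 1)"]
      by (cases "x \<in> set xs") (auto simp: lookup_add lookup_single when_def split: if_splits)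
    have "\<not> (x = v \<and> y \<in> set xs)" if "{x, y} \<in> E" for x y
      using v that by (auto simp: closed_nbhd_def)
    moreover have "u \<noteq> w" using simple e(1) by (auto simp: simple_graph_def)
    ultimately show ?thesis using pos[OF e(2)] pos[OF e(3)] e(1) by (metis insert_commute)
  qed
  ultimately have "2 * s \<le> weight (set xs) ?m" by (rule edge_products_weight)
  then show False using s weight_witness[OF subset_refl, of 1] vC by (simp add: weight_add weight_single)
qed

text \<open>The \<open>k\<close> missing degrees of the witness must come from the \<open>j\<close>
  copies of \<open>v\<close>.\<close>

lemma times_witness_degree:
  assumes "Poly_Mapping.single v j + witness k r \<in> edge_products E (k * (n + 1) + r)"
  shows "k \<le> j"
  using edge_products_weight[OF assms, of UNIV] weight_witness[of UNIV k r]
  by (simp add: weight_add weight_single algebra_simps)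

end

section \<open>Odd cycles with leaves and the upper bound\<close>

locale whiskered_odd_cycle = odd_unicyclic E xs n
  for E :: "'v::finite set set" and xs :: "'v list" and n :: nat +
  assumes dominated: "\<forall>v. v \<in> closed_nbhd E (set xs)"
begin

lemma outside_edge:
  assumes "l \<notin> set xs" "{l, y} \<in> E"
  shows "y \<in> set xs" and "{l, z} \<in> E \<Longrightarrow> z = y"
proof -
  have in_cycle: "z \<in> set xs" if "{l, z} \<in> E" for z
    using unicyclic_outside_independent[OF uni dominated assms(1)] that by blast
  then show "y \<in> set xs" using assms by blast
  show "{l, z} \<in> E \<Longrightarrow> z = y"
    using unicyclic_unique_cycle_neighbour[OF uni assms(1), of z y] in_cycle assms(2) by blast
qed

text \<open>If no leaf edge has positive exponents at both ends, the vertices with exponent 0 cover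
  all leaf edges at no cost. So the exponents on the cycle alone satisfy the cover condition, and
  the cycle packing applies.\<close>

lemma cycle_decomposition:
  assumes cover: "\<And>W. vertex_cover E W \<Longrightarrow> s \<le> weight W m"
    and zero: "\<And>l y. \<lbrakk>l \<notin> set xs; {l, y} \<in> E\<rbrakk> \<Longrightarrow> lookup m l = 0 \<or> lookup m y = 0"
  shows "\<exists>j q. \<exists>t\<in>edge_products E q. s \<le> j * (n + 1) + q \<and>
    (\<forall>v. j * lookup (cycle_product xs) v + lookup t v \<le> lookup m v)"
proof -
  let ?N = "2 * n + 1"
  define a where "a i = lookup m (xs ! i)" for i
  have inj: "inj_on ((!) xs) {..<?N}" using inj_on_nth[OF dist] len by auto
  have "cycle_covered ?N a s"
    unfolding cycle_covered_def
  proof (intro allI impI)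
    fix S assume S: "S \<subseteq> {..<?N}" "\<forall>i<?N. i \<in> S \<or> Suc i mod ?N \<in> S"
    define W where "W = (!) xs ` S \<union> {v. lookup m v = 0}"
    have "vertex_cover E W"
      unfolding vertex_cover_def
    proof (intro allI impI)
      fix u v assume e: "{u, v} \<in> E"
      show "u \<in> W \<or> v \<in> W"
      proof (cases "u \<in> set xs \<and> v \<in> set xs")
        case True
        then have "{u, v} \<in> cycle_edges xs" using unicyclic_no_chord[OF uni e] by blast
        then obtain i where i: "i < ?N" "{u, v} = {xs ! i, xs ! (Suc i mod ?N)}"
          unfolding cycle_edges_def len by blast
        have "xs ! i \<in> W \<or> xs ! (Suc i mod ?N) \<in> W" using S(2) i(1) unfolding W_def by blast
        with i(2) obtain p q where "{u, v} = {p, q}" "p \<in> W \<or> q \<in> W" by blast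
        then show ?thesis by (auto simp: doubleton_eq_iff)
      next
        case False
        then have "lookup m u = 0 \<or> lookup m v = 0"
          using zero[of u v] zero[of v u] e insert_commute[of v u "{}"] by auto
        then show ?thesis unfolding W_def by blast
      qed
    qed
    then have "s \<le> weight W m" by (rule cover)
    also have "\<dots> = sum (lookup m) ((!) xs ` S)"
      unfolding weight_def by (rule sum.mono_neutral_right) (auto simp: W_def)
    also have "\<dots> = sum a S"
      using inj_on_subset[OF inj S(1)] by (simp add: sum.reindex a_def)
    finally show "s \<le> sum a S" .
  qed
  from odd_cycle_packing[OF this] obtain j y where
    jy: "cycle_packing ?N a j y" "s \<le> j * (n + 1) + sum y {..<?N}" by blast
  \<comment> \<open>The packing is read back in the graph: \<open>t\<close> collects
    \<open>y i\<close> copies of each edge \<open>e i\<close>.\<close>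
  define e where "e i = Poly_Mapping.single (xs ! i) (1 :: nat) +
    Poly_Mapping.single (xs ! (Suc i mod ?N)) 1" for i
  define t where "t = (\<Sum>i<?N. \<Sum>k<y i. e i)"
  have "(\<Sum>k<y i. e i) \<in> edge_products E (y i)" if "i < ?N" for i
    using iterated_sumset_mult[OF upclosed_edge_exponents edge_mem_edge_products[OF cycle_edge[OF that]], of "y i"]
    unfolding e_def by simp
  then have "t \<in> edge_products E (sum y {..<?N})"
    unfolding t_def by (intro edge_products_sum) auto
  moreover have "j * lookup (cycle_product xs) v + lookup t v \<le> lookup m v" for v
  proof (cases "v \<in> set xs")
    case True
    then obtain p where p: "p < ?N" "v = xs ! p" using len by (metis in_set_conv_nth)
    \<comment> \<open>The cyclic predecessor of \<open>p\<close>: the cycle edges at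
      \<open>v\<close> are those numbered \<open>p\<close> and \<open>p'\<close>.\<close>
    define p' where "p' = (p + (?N - 1 mod ?N)) mod ?N"
    have p': "p' < ?N" "Suc p' mod ?N = p"
      using shift_mod(1)[of ?N p 1] p(1) unfolding p'_def by simp_all
    have pred: "Suc i mod ?N = p \<longleftrightarrow> i = p'" if "i < ?N" for i
    proof
      assume "Suc i mod ?N = p"
      then show "i = p'" using shift_mod(2)[of ?N i 1] that unfolding p'_def by simp
    qed (use p'(2) in simp)
    have index: "xs ! i = v \<longleftrightarrow> i = p" if "i < ?N" for i
      using nth_eq_iff_index_eq[OF dist, of i p] that p len by simp
    have eq: "lookup (e i) v = (if i = p then 1 else 0) + (if i = p' then 1 else 0)" if i: "i < ?N" for i
    proof -
      have "Suc i mod ?N < ?N" by simp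
      from index[OF i] index[OF this] pred[OF i] show ?thesis
        unfolding e_def lookup_add lookup_single when_def by presburger
    qed
    have "lookup t v = (\<Sum>i<?N. y i * lookup (e i) v)"
      unfolding t_def lookup_sum[of _ "{..<?N}"] lookup_copies ..
    also have "\<dots> = (\<Sum>i<?N. (if i = p then y i else 0) + (if i = p' then y i else 0))"
      by (intro sum.cong) (auto simp: eq)
    also have "\<dots> = y p + y p'" using p(1) p'(1) unfolding sum.distrib by (simp only: sum.delta finite_lessThan lessThan_iff if_True)
    finally have "lookup t v = y p + y p'" .
    moreover have "j + y p' + y p \<le> lookup m v"
      using jy(1)[unfolded cycle_packing_def, rule_format, OF p'(1)] unfolding p'(2) a_def p(2) .
    ultimately show ?thesis using True by (simp add: lookup_cycle_product)
  next
    case False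
    then have "xs ! i \<noteq> v" if "i < ?N" for i using that len by auto
    then have "lookup t v = 0" unfolding t_def e_def lookup_sum lookup_add
      by (intro sum.neutral ballI) (simp add: lookup_single_not_eq)
    then show ?thesis using False by (simp add: lookup_cycle_product)
  qed
  ultimately show ?thesis using jy(2) by blast
qed

text \<open>A leaf edge meets every minimal cover in exactly one vertex, so it can be split off as long as both
  of its end points have positive exponent. After that, zero exponents cover the leaf edges for free.\<close>

theorem symbolic_decomposition:
  assumes "\<And>W. vertex_cover E W \<Longrightarrow> s \<le> weight W m"
  shows "\<exists>j q. \<exists>t\<in>edge_products E q. s \<le> j * (n + 1) + q \<and>
    (\<forall>v. j * lookup (cycle_product xs) v + lookup t v \<le> lookup m v)"
  using assms
proof (induction s arbitrary: m)
  case 0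
  show ?case by (intro exI[of _ 0] bexI[of _ 0]) auto
next
  case (Suc s)
  show ?case
  proof (cases "\<forall>l y. l \<notin> set xs \<longrightarrow> {l, y} \<in> E \<longrightarrow> lookup m l = 0 \<or> lookup m y = 0")
    case True
    then show ?thesis by (intro cycle_decomposition[OF Suc.prems]) auto
  next
    case False
    then obtain l y where l: "l \<notin> set xs" "{l, y} \<in> E" "0 < lookup m l" "0 < lookup m y" by auto
    have ly: "l \<noteq> y" using outside_edge(1)[OF l(1,2)] l(1) by blast
    define e where "e = Poly_Mapping.single l (1 :: nat) + Poly_Mapping.single y 1"
    have m: "e + (m - e) = m"
      by (rule add_diff_exponent) (use l ly in \<open>auto simp: e_def lookup_add lookup_single when_def\<close>)
    have "s \<le> weight W (m - e)" if W: "vertex_cover E W" for W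
    proof -
      define V where "V = (if y \<in> W then W - {l} else W)"
      have "vertex_cover E V"
      proof (cases "y \<in> W")
        case True
        show ?thesis
          unfolding vertex_cover_def
        proof (intro allI impI)
          fix u v assume "{u, v} \<in> E"
          then show "u \<in> V \<or> v \<in> V"
            using W True ly outside_edge(2)[OF l(1,2)] unfolding V_def vertex_cover_def
            by (metis DiffI insert_commute singletonD)
        qed
      qed (use W in \<open>simp add: V_def\<close>)
      moreover have "weight V e = 1"
        using W l(2) ly unfolding vertex_cover_def V_def e_def by (auto simp: weight_add weight_single)
      ultimately have "s \<le> weight V (m - e)" using Suc.prems[of V] weight_add[of V e "m - e"] m by simp
      also have "\<dots> \<le> weight W (m - e)" unfolding weight_def V_def by (rule sum_mono2) auto
      finally show ?thesis .
    qed
    from Suc.IH[OF this] obtain j q t where t: "t \<in> edge_products E q" "s \<le> j * (n + 1) + q"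
      "\<And>v. j * lookup (cycle_product xs) v + lookup t v \<le> lookup (m - e) v" by blast
    have "t + e \<in> edge_products E (q + 1)"
      unfolding e_def
      by (rule iterated_sumset_add[OF upclosed_edge_exponents t(1) edge_mem_edge_products[OF l(2)]])
    moreover have "j * lookup (cycle_product xs) v + lookup (t + e) v \<le> lookup m v" for v
      using t(3)[of v] arg_cong[OF m, of "\<lambda>m. lookup m v"] by (simp add: lookup_add)
    ultimately show ?thesis using t(2) by (intro exI[of _ j] exI[of _ "q + 1"] bexI[of _ "t + e"]) auto
  qed
qed

text \<open>Every vertex is in the closed neighbourhood of the cycle, so each variable of
  \<open>x\<close> turns one cycle product into \<open>n + 1\<close> edges.\<close>

lemma degree_times_cycle_products:
  assumes "j \<le> weight UNIV x"
  shows "x + (\<Sum>i<j. cycle_product xs) \<in> edge_products E (j * (n + 1))"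
  using assms
proof (induction j arbitrary: x)
  case (Suc j)
  have "x \<in> sumset (range (\<lambda>v. Poly_Mapping.single v 1)) UNIV"
    unfolding exponents_weight_pos_eq using Suc.prems by simp
  then obtain v b where x: "x = Poly_Mapping.single v 1 + b" by (auto simp: sumset_def)
  have "j \<le> weight UNIV b" using Suc.prems by (simp add: x weight_add weight_single)
  from iterated_sumset_add[OF upclosed_edge_exponents Suc.IH[OF this] cycle_product_closed_nbhd[of v]]
  show ?case using dominated by (simp add: x add_ac)
qed simp

lemma degree_times_symbolic:
  assumes s: "s = k * (n + 1) + r" "r \<le> n"
    and z: "\<And>W. vertex_cover E W \<Longrightarrow> s \<le> weight W z" and x: "k \<le> weight UNIV x"
  shows "x + z \<in> edge_products E s"
proof -
  obtain j q t where t: "t \<in> edge_products E q" "s \<le> j * (n + 1) + q"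
    "\<And>v. j * lookup (cycle_product xs) v + lookup t v \<le> lookup z v"
    using symbolic_decomposition[OF z] by blast
  note up = upclosed_edge_exponents[of E]
  show ?thesis
  proof (cases "j \<le> k")
    case True
    have "(x + (\<Sum>i<j. cycle_product xs)) + t \<in> edge_products E (j * (n + 1) + q)"
      by (intro iterated_sumset_add[OF up] degree_times_cycle_products t(1)) (use x True in simp)
    then have "(x + (\<Sum>i<j. cycle_product xs)) + t \<in> edge_products E s"
      using iterated_sumset_antimono[OF up t(2)] by blast
    then show ?thesis
      by (rule upclosed_mono[OF upclosed_iterated_sumset[OF up]])
        (use t(3) in \<open>simp add: lookup_add lookup_copies add.assoc\<close>)
  next
    case False
    \<comment> \<open>Here \<open>k + 1\<close> cycle products divide \<open>z\<close>:
      \<open>k\<close> of them become \<open>n + 1\<close> edges each by means of \<open>x\<close>,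
      and the last is worth \<open>n \<ge> r\<close> edges.\<close>
    have "(x + (\<Sum>i<k. cycle_product xs)) + cycle_product xs \<in> edge_products E (k * (n + 1) + n)"
      by (intro iterated_sumset_add[OF up] degree_times_cycle_products x cycle_product_mem)
    then have "(x + (\<Sum>i<k. cycle_product xs)) + cycle_product xs \<in> edge_products E s"
      using iterated_sumset_antimono[OF up, of s "k * (n + 1) + n"] s by auto
    moreover have "lookup ((x + (\<Sum>i<k. cycle_product xs)) + cycle_product xs) v \<le> lookup (x + z) v" for v
    proof -
      have "Suc k * lookup (cycle_product xs) v \<le> j * lookup (cycle_product xs) v"
        using False by (intro mult_le_mono1) simp
      also have "\<dots> \<le> lookup z v" using t(3)[of v] by linarith
      finally show ?thesis by (simp add: lookup_add lookup_copies)
    qed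
    ultimately show ?thesis by (rule upclosed_mono[OF upclosed_iterated_sumset[OF up]])
  qed
qed

text \<open>Necessity comes from the witness. For sufficiency, adding exponents is enough, since the
  terms of a symbolic element are controlled by their weights on covers.\<close>

theorem max_ideal_pow_annihilates_iff:
  assumes s: "s = k * (n + 1) + r" "r \<le> n"
  shows "(\<forall>a\<in>ideal_pow vpoly_ring max_ideal j. \<forall>f\<in>symbolic_power vpoly_ring (edge_ideal E) s.
      a * f \<in> (ideal_pow vpoly_ring (edge_ideal E) s :: ('v, 'k::field) vpoly set)) \<longleftrightarrow> k \<le> j"
    (is "?L \<longleftrightarrow> _")
proof
  assume L: ?L
  have "(Poly_Mapping.single (Poly_Mapping.single v j) 1 :: ('v, 'k) vpoly)
      * Poly_Mapping.single (witness k r) 1 \<in> ideal_pow vpoly_ring (edge_ideal E) s" for v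
    using L witness_symbolic[of k r, folded s(1), where 'k = 'k]
    by (simp add: max_ideal_pow_eq weight_single)
  \<comment> \<open>Any vertex serves; \<open>undefined\<close> picks one.\<close>
  then have "Poly_Mapping.single undefined j + witness k r \<in> edge_products E (k * (n + 1) + r)"
    by (simp add: mult_single edge_ideal_pow_eq s(1))
  then show "k \<le> j" by (rule times_witness_degree)
next
  assume "k \<le> j"
  show ?L
  proof (intro ballI)
    fix a f :: "('v, 'k) vpoly"
    assume a: "a \<in> ideal_pow vpoly_ring max_ideal j" and f: "f \<in> symbolic_power vpoly_ring (edge_ideal E) s"
    have "x + z \<in> edge_products E s" if "x \<in> keys a" "z \<in> keys f" for x z
    proof (rule degree_times_symbolic[OF s])
      show "s \<le> weight W z" if "vertex_cover E W" for W
        using symbolic_power_weight[OF simple that f \<open>z \<in> keys f\<close>] .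
      show "k \<le> weight UNIV x"
        using a \<open>x \<in> keys a\<close> \<open>k \<le> j\<close> by (force simp: max_ideal_pow_eq monomial_ideal_def)
    qed
    then show "a * f \<in> ideal_pow vpoly_ring (edge_ideal E) s"
      using keys_mult[of a f] by (force simp: edge_ideal_pow_eq monomial_ideal_def)
  qed
qed

end

section \<open>Both cases of the annihilator and growth of the exponent\<close>

theorem mainTheorem5:
  fixes E :: "'v::finite set set" and xs :: "'v list"
    and n s r :: nat and k :: int
    and R :: "('v, 'k::field) vpoly ring"
    and I \<mm> :: "('v, 'k) vpoly set"
  assumes R: "R = vpoly_ring"
    and uni: "unicyclic E xs"
    and len: "length xs = 2 * n + 1"
    and I: "I = edge_ideal E"
    and m: "\<mm> = max_ideal"
    and s_eq: "int s = k * (int n + 1) + int r"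
    and r: "r \<le> n"
    and s: "n + 1 \<le> s"
  shows
    "((\<exists>v. v \<notin> closed_nbhd E (set xs)) \<longrightarrow>
       (\<forall>\<gamma>::nat.
          \<not> ideal_prod R (ideal_pow R \<mm> \<gamma>) (symbolic_power R I s) \<subseteq> ideal_pow R I s \<and>
          \<not> ideal_pow R \<mm> \<gamma> \<subseteq>
              annihilator R (quot_module R (symbolic_power R I s) (ideal_pow R I s))))
     \<and>
     ((\<forall>v. v \<in> closed_nbhd E (set xs)) \<longrightarrow>
       ideal_prod R (ideal_pow R \<mm> (nat k)) (symbolic_power R I s) \<subseteq> ideal_pow R I s \<and>
       \<not> ideal_prod R (ideal_pow R \<mm> (nat (k - 1))) (symbolic_power R I s) \<subseteq> ideal_pow R I s \<and>
       (\<forall>j::nat. ideal_prod R (ideal_pow R \<mm> j) (symbolic_power R I s) \<subseteq> ideal_pow R I s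
                  \<longrightarrow> k \<le> int j) \<and>
       (\<forall>\<gamma>::nat. k \<le> int \<gamma> \<longrightarrow>
          ideal_pow R \<mm> \<gamma> \<subseteq>
            annihilator R (quot_module R (symbolic_power R I s) (ideal_pow R I s))) \<and>
       int (least_exponent I s) = k \<and>
       mono_on {n + 1..} (least_exponent I) \<and>
       filterlim (least_exponent I) at_top at_top)"
proof (intro conjI[of "_ \<longrightarrow> _" "_ \<longrightarrow> _"] impI)
  interpret odd_unicyclic E xs n by unfold_locales (fact uni, fact len)
  note prod_iff = ideal_prod_subset_iff[OF ideal_edge_ideal_pow]
    and ann_iff = subset_annihilator_iff[OF ideal_edge_ideal_pow]
  {
    assume "\<exists>v. v \<notin> closed_nbhd E (set xs)"
    then obtain v where v: "v \<notin> closed_nbhd E (set xs)" by blast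
    have "\<not> (\<forall>a\<in>ideal_pow vpoly_ring max_ideal \<gamma>. \<forall>f\<in>symbolic_power vpoly_ring (edge_ideal E) s.
        a * f \<in> (ideal_pow vpoly_ring (edge_ideal E) s :: ('v, 'k) vpoly set))" for \<gamma>
    proof
      assume h: "\<forall>a\<in>ideal_pow vpoly_ring max_ideal \<gamma>. \<forall>f\<in>symbolic_power vpoly_ring (edge_ideal E) s.
        a * f \<in> (ideal_pow vpoly_ring (edge_ideal E) s :: ('v, 'k) vpoly set)"
      have "(Poly_Mapping.single (witness 1 (s - (n + 1))) 1 :: ('v, 'k) vpoly)
          \<in> symbolic_power vpoly_ring (edge_ideal E) s"
        using witness_symbolic[of 1 "s - (n + 1)", where 'k = 'k] s by simp
      \<comment> \<open>The power of \<open>v\<close> lies in the \<open>\<gamma>\<close>-th power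
        of the maximal ideal but cannot repair the witness.\<close>
      with h have "(Poly_Mapping.single (Poly_Mapping.single v \<gamma>) 1 :: ('v, 'k) vpoly)
          * Poly_Mapping.single (witness 1 (s - (n + 1))) 1 \<in> ideal_pow vpoly_ring (edge_ideal E) s"
        by (simp add: max_ideal_pow_eq weight_single)
      then show False
        using times_witness_not_in_power_outside[OF v s] by (simp add: mult_single edge_ideal_pow_eq)
    qed
    then show "\<forall>\<gamma>::nat.
          \<not> ideal_prod R (ideal_pow R \<mm> \<gamma>) (symbolic_power R I s) \<subseteq> ideal_pow R I s \<and>
          \<not> ideal_pow R \<mm> \<gamma> \<subseteq>
              annihilator R (quot_module R (symbolic_power R I s) (ideal_pow R I s))"
      unfolding R I m prod_iff ann_iff by blast
  }
  assume "\<forall>v. v \<in> closed_nbhd E (set xs)"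
  then interpret whiskered_odd_cycle E xs n by unfold_locales
  \<comment> \<open>Positivity of \<open>k\<close> makes \<open>nat k\<close> and
    \<open>nat (k - 1)\<close> exact.\<close>
  have k: "1 \<le> k"
  proof (rule ccontr)
    assume "\<not> 1 \<le> k"
    then have "k * (int n + 1) \<le> 0" by (intro mult_nonpos_nonneg) auto
    then show False using s_eq r s by linarith
  qed
  then have "int s = int (nat k * (n + 1) + r)" using s_eq by (simp add: algebra_simps)
  then have sk: "s = nat k * (n + 1) + r" by linarith
  \<comment> \<open>Proved for all \<open>t\<close> at once: the quotient is then the least exponent
    for every \<open>t\<close>, which gives monotonicity and divergence.\<close>
  have iff: "ideal_prod vpoly_ring (ideal_pow vpoly_ring max_ideal j) (symbolic_power vpoly_ring (edge_ideal E) t)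
      \<subseteq> (ideal_pow vpoly_ring (edge_ideal E) t :: ('v, 'k) vpoly set) \<longleftrightarrow> t div (n + 1) \<le> j" for j t
    unfolding prod_iff
    by (rule max_ideal_pow_annihilates_iff[of t "t div (n + 1)" "t mod (n + 1)"])
      (simp_all only: div_mult_mod_eq, simp add: less_Suc_eq_le[symmetric])
  have least: "least_exponent (edge_ideal E :: ('v, 'k) vpoly set) t = t div (n + 1)" for t
    unfolding least_exponent_def iff by (rule Least_equality) simp_all
  have sdiv: "s div (n + 1) = nat k"
    unfolding sk by (rule div_nat_eqI) (use r in \<open>simp_all add: algebra_simps\<close>)
  have "mono_on {n + 1..} (\<lambda>t. t div (n + 1))" by (intro mono_onI div_le_mono)
  moreover have "filterlim (\<lambda>t. t div (n + 1)) at_top at_top"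
    unfolding filterlim_at_top
  proof
    fix Z
    show "\<forall>\<^sub>F t in at_top. Z \<le> t div (n + 1)"
      using eventually_ge_at_top[of "Z * (n + 1)"]
      by eventually_elim (simp add: less_eq_div_iff_mult_less_eq)
  qed
  ultimately show "ideal_prod R (ideal_pow R \<mm> (nat k)) (symbolic_power R I s) \<subseteq> ideal_pow R I s \<and>
       \<not> ideal_prod R (ideal_pow R \<mm> (nat (k - 1))) (symbolic_power R I s) \<subseteq> ideal_pow R I s \<and>
       (\<forall>j::nat. ideal_prod R (ideal_pow R \<mm> j) (symbolic_power R I s) \<subseteq> ideal_pow R I s
                  \<longrightarrow> k \<le> int j) \<and>
       (\<forall>\<gamma>::nat. k \<le> int \<gamma> \<longrightarrow>
          ideal_pow R \<mm> \<gamma> \<subseteq>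
            annihilator R (quot_module R (symbolic_power R I s) (ideal_pow R I s))) \<and>
       int (least_exponent I s) = k \<and>
       mono_on {n + 1..} (least_exponent I) \<and>
       filterlim (least_exponent I) at_top at_top"
    unfolding R I m ann_iff prod_iff[symmetric] iff least sdiv using k by auto
qed

end
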